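(* Let $Q=[Q_{i,j}]$ be a random symmetric $n\times n$ matrix whose entries $Q_{i,j}$, $1\le i\le j\le n$, are i.i.d. with a continuous cumulative distribution function $F$, and let $K_n$ be the support size of a global minimizer $\mathbf X^*$ of $\mathbf x^TQ\mathbf x$ over the standard simplex $\Delta_n$. Suppose that $F$ has a continuous density $f$ supported by $[A,B)$, $-\infty<A<B\le\infty$, with $A=0$ (a normalization by shifting), such that: (1) $f(x)>0$ for $x\in[0,B)$; (2) there exist $\nu>0$ and $\rho>0$ such that $F(x)=\rho x^{\nu}+O(x^{\nu+1})$ as $x\downarrow 0$; (3) $\displaystyle \beta:=\sup\left\{\frac{f(x')}{f(x)}:\ x,x'\in(0,B),\ x'\in(x,2x)\right\}<\infty.$ Then, for $k\le k_n$, $$\Pr\{K_n=k\}\le \exp\bigl(-c(\max(\nu,1))\,k+o(k)\bigr),\qquad c(\mu):=\int_0^1\log(1+x^{\mu})\,dx=\sum_{j\ge1}\frac{(-1)^{j-1}}{j(j\mu+1)} .$$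
   Context: $\Delta_n=\{\mathbf x\in\mathbb R^n:\ \mathbf x\ge \mathbf 0,\ \sum_{j}x_j=1\}$. $\mathbf X^*$ denotes a global minimum solution of the problem of minimizing $\mathbf x^TQ\mathbf x$ over $\Delta_n$, and $K_n=|\{j\in[n]: X^*_j>0\}|$. $k_n=\lceil\alpha n^{1/2}\rceil$, where $\alpha>e\sqrt2$ is a fixed constant. Continuity of the density $f$ is understood on the open interval $(0,B)$. The asymptotics are as $n\to\infty$; $o(k)$ denotes a quantity whose ratio to $k$ tends to $0$ as $n,k\to\infty$ with $k\le k_n$. *)

theory Defs
  imports "HOL-Probability.Probability" "HOL-Library.Landau_Symbols"
begin

text \<open>
  The dimension varies, so a vector of \<open>\<real>\<^sup>n\<close> is an extensional function on \<open>{1..n}\<close> (a point of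
  the space of the product measure over \<open>{1..n}\<close>), and an \<open>n \<times> n\<close> matrix is a function
  \<open>q :: nat \<Rightarrow> nat \<Rightarrow> real\<close> of which only the entries with indices in \<open>{1..n}\<close> are used.
\<close>

definition std_simplex :: "nat \<Rightarrow> (nat \<Rightarrow> real) set" where
  "std_simplex n =
     {x \<in> {1..n} \<rightarrow>\<^sub>E UNIV. (\<forall>j\<in>{1..n}. 0 \<le> x j) \<and> (\<Sum>j=1..n. x j) = 1}"

definition quad_form :: "nat \<Rightarrow> (nat \<Rightarrow> nat \<Rightarrow> real) \<Rightarrow> (nat \<Rightarrow> real) \<Rightarrow> real" where
  "quad_form n q x = (\<Sum>i=1..n. \<Sum>j=1..n. x i * q i j * x j)"

definition is_global_minimizer ::
    "nat \<Rightarrow> (nat \<Rightarrow> nat \<Rightarrow> real) \<Rightarrow> (nat \<Rightarrow> real) \<Rightarrow> bool" where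
  "is_global_minimizer n q x \<longleftrightarrow> is_arg_min (quad_form n q) (\<lambda>y. y \<in> std_simplex n) x"

definition support_size :: "nat \<Rightarrow> (nat \<Rightarrow> real) \<Rightarrow> nat" where
  "support_size n x = card {j \<in> {1..n}. x j > 0}"

text \<open>
  The nonnegative integral is used so that no integrability side condition is hidden in the
  default value of a Bochner integral.
\<close>

definition has_density :: "(real \<Rightarrow> real) \<Rightarrow> (real \<Rightarrow> real) \<Rightarrow> bool" where
  "has_density F f \<longleftrightarrow>
     f \<in> borel_measurable borel \<and> (\<forall>x. 0 \<le> f x) \<and>
     (\<forall>x. ennreal (F x) = (\<integral>\<^sup>+ t\<in>{..x}. ennreal (f t) \<partial>lborel))"

definition k_max :: "real \<Rightarrow> nat \<Rightarrow> nat" where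
  "k_max \<alpha> n = nat \<lceil>\<alpha> * sqrt (real n)\<rceil>"

definition c_rate :: "real \<Rightarrow> real" where
  "c_rate \<mu> = integral {0..1} (\<lambda>x. ln (1 + x powr \<mu>))"

text \<open>
  \<open>n, k \<rightarrow> \<infinity>\<close> jointly, subject to \<open>k \<le> k_max \<alpha> n\<close>.
\<close>

definition joint_filter :: "real \<Rightarrow> (nat \<times> nat) filter" where
  "joint_filter \<alpha> =
     inf (sequentially \<times>\<^sub>F sequentially) (principal {(n, k). k \<le> k_max \<alpha> n})"

end

theory Submission imports Defs "HOL-Real_Asymp.Real_Asymp" begin

text \<open>
  Let \<open>\<lambda>\<close> be the minimal value of the quadratic form and \<open>I\<close> the support of the minimizer, \<open>card I = k\<close>. Comparison with
  the vertices of the simplex gives \<open>\<lambda> \<le> Q l l\<close> for every \<open>l\<close>, and shifting mass away from an index of \<open>I\<close> gives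
  \<open>(Q x) i \<le> \<lambda>\<close> for \<open>i \<in> I\<close>. Summing the latter over \<open>I\<close> and using symmetry, the \<open>x\<close>-weighted mean of the row sums
  \<open>\<Sum>i\<in>I. Q j i\<close> is at most \<open>k \<lambda>\<close>. So there is a light row (\<open>minimizer_light_row\<close>): some \<open>j \<in> I\<close> for which \<open>k - 1\<close>
  off-diagonal entries of row \<open>j\<close> have an average not exceeding the smallest diagonal entry. The theorem measures how
  rare this is.
  
  Fix \<open>j\<close> and pass to the uniform variables \<open>F (Q j i)\<close>. On the scale \<open>1/n\<close> the order statistics of row \<open>j\<close> have
  nearly independent exponential gaps, and all diagonal entries exceed a level \<open>t\<close> with probability about
  \<open>exp (- n F t)\<close>. When \<open>t\<close> is the average of the \<open>m\<close> smallest entries, the power law of \<open>F\<close> at \<open>0\<close> together with a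
  convexity inequality (\<open>powr_mean_ge_wsum\<close>) bounds \<open>F t\<close> from below by a linear form in the gaps with coefficients
  \<open>(l/m) powr \<mu>\<close>, \<open>\<mu> = max \<nu> 1\<close>. The expectation of the exponential then factors into
  \<open>\<Prod>l. 1 / (1 + (l/m) powr \<mu>)\<close> (\<open>chain_integral\<close>, \<open>chain_event_prob\<close>), and minus the logarithm of this product is a Riemann
  sum for \<open>m\<close> times the rate.
  
  A union bound over \<open>j\<close> would cost a factor \<open>n\<close>, too much when \<open>k\<close> is at most logarithmic in \<open>n\<close>. But the light row
  also forces \<open>Q j j \<le> k \<lambda>\<close>. Up to an event of probability \<open>exp (- (1 + c) k)\<close>, with \<open>c\<close> the rate, the smallest diagonal entry
  is of order at most \<open>(k/n) powr (1/\<nu>)\<close>, so this further event has probability \<open>O(k powr (\<nu> + 1) / n)\<close> and is independent of the rest. The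
  choice of \<open>j\<close> then costs only a power of \<open>k\<close> (\<open>support_size_prob_le\<close>).
  
  The power law is available only near \<open>0\<close>, while an average being small does not make every entry small. Giving up a
  small share of the \<open>k - 1\<close> entries repairs this (\<open>smallest_entries\<close>), at the price of an error absorbed in \<open>o(k)\<close>.
\<close>

section \<open>First-order conditions at a minimizer\<close>

text \<open>
  The vertices of the simplex are competitors.
\<close>
lemma minimizer_value_le_diagonal:
  assumes min: "is_global_minimizer n q x" and l: "l \<in> {1..n}"
  shows "quad_form n q x \<le> q l l"
proof -
  define e where "e = (\<lambda>j. if j \<in> {1..n} then (if j = l then 1 else 0) else undefined :: real)"
  have e: "e \<in> std_simplex n"
    using l by (auto simp: std_simplex_def e_def)
  have "quad_form n q e = (\<Sum>i=1..n. \<Sum>j=1..n. if i = l then (if j = l then q l l else 0) else 0)"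
    unfolding quad_form_def by (intro sum.cong) (auto simp: e_def)
  also have "\<dots> = q l l"
  proof -
    have "(\<Sum>j=1..n. if i = l then (if j = l then q l l else 0) else 0) = (if i = l then q l l else 0)" for i
      using l by (cases "i = l") auto
    then show ?thesis using l by simp
  qed
  finally show ?thesis
    using min e unfolding is_global_minimizer_def is_arg_min_linorder by auto
qed

lemma quad_form_shift:
  assumes i: "i \<in> {1..n}" and sym: "\<And>a b. a \<in> {1..n} \<Longrightarrow> b \<in> {1..n} \<Longrightarrow> q a b = q b a"
    and y: "\<And>j. j \<in> {1..n} \<Longrightarrow> y j = s * x j - (if j = i then t else 0)"
  shows "quad_form n q y = s\<^sup>2 * quad_form n q x - 2 * s * t * (\<Sum>j=1..n. q i j * x j) + t\<^sup>2 * q i i"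
proof -
  define d where "d = (\<lambda>j. if j = i then 1 else 0 :: real)"
  have y': "y j = s * x j - t * d j" if "j \<in> {1..n}" for j using y[OF that] by (simp add: d_def)
  have "quad_form n q y = (\<Sum>a=1..n. \<Sum>b=1..n. s\<^sup>2 * (x a * q a b * x b) - s * t * (d a * (q a b * x b))
       - s * t * (d b * (q a b * x a)) + t\<^sup>2 * (d a * (d b * q a b)))"
    unfolding quad_form_def by (intro sum.cong refl) (simp add: y' algebra_simps power2_eq_square)
  also have "\<dots> = s\<^sup>2 * quad_form n q x - s * t * (\<Sum>a=1..n. d a * (\<Sum>b=1..n. q a b * x b))
       - s * t * (\<Sum>a=1..n. \<Sum>b=1..n. d b * (q a b * x a)) + t\<^sup>2 * (\<Sum>a=1..n. d a * (\<Sum>b=1..n. d b * q a b))"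
    unfolding quad_form_def by (simp add: sum.distrib sum_subtractf sum_distrib_left)
  also have "(\<Sum>a=1..n. d a * (\<Sum>b=1..n. q a b * x b)) = (\<Sum>j=1..n. q i j * x j)"
    unfolding d_def using i by (subst sum.cong[OF refl, of _ _ "\<lambda>a. if a = i then (\<Sum>b=1..n. q a b * x b) else 0"]) auto
  also have "(\<Sum>a=1..n. \<Sum>b=1..n. d b * (q a b * x a)) = (\<Sum>a=1..n. q a i * x a)"
  proof (intro sum.cong refl)
    fix a
    have "(\<Sum>b=1..n. d b * (q a b * x a)) = (\<Sum>b=1..n. if b = i then q a b * x a else 0)"
      by (intro sum.cong) (auto simp: d_def)
    then show "(\<Sum>b=1..n. d b * (q a b * x a)) = q a i * x a" using i by simp
  qed
  also have "(\<Sum>a=1..n. q a i * x a) = (\<Sum>j=1..n. q i j * x j)"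
    using sym i by (intro sum.cong refl) auto
  also have "(\<Sum>a=1..n. d a * (\<Sum>b=1..n. d b * q a b)) = q i i"
  proof -
    have "(\<Sum>b=1..n. d b * q a b) = q a i" for a
    proof -
      have "(\<Sum>b=1..n. d b * q a b) = (\<Sum>b=1..n. if b = i then q a b else 0)"
        by (intro sum.cong) (auto simp: d_def)
      then show ?thesis using i by simp
    qed
    then have "(\<Sum>a=1..n. d a * (\<Sum>b=1..n. d b * q a b)) = (\<Sum>a=1..n. if a = i then q a i else 0)"
      by (intro sum.cong) (auto simp: d_def)
    then show ?thesis using i by simp
  qed
  finally show ?thesis by (simp add: algebra_simps)
qed

text \<open>
  Replace \<open>x\<close> by \<open>(1 + t) x - t e\<^sub>i\<close>, which stays in the simplex for small \<open>t > 0\<close> because \<open>x\<^sub>i > 0\<close>.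
  The derivative at \<open>t = 0\<close> of the value is twice the difference of the two sides.
\<close>
lemma minimizer_row_le_value:
  assumes min: "is_global_minimizer n q x" and i: "i \<in> {1..n}" and pos: "x i > 0"
    and sym: "\<And>a b. a \<in> {1..n} \<Longrightarrow> b \<in> {1..n} \<Longrightarrow> q a b = q b a"
  shows "(\<Sum>j=1..n. q i j * x j) \<le> quad_form n q x"
proof -
  define L where "L = quad_form n q x"
  define R where "R = (\<Sum>j=1..n. q i j * x j)"
  have x: "x \<in> std_simplex n" and le: "\<And>y. y \<in> std_simplex n \<Longrightarrow> L \<le> quad_form n q y"
    using min unfolding is_global_minimizer_def is_arg_min_linorder L_def by auto
  have ge: "0 \<le> 2 * (L - R) + t * (L - 2 * R + q i i)" if t: "0 < t" "t \<le> x i" for t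
  proof -
    \<comment> \<open>Points of the simplex are extensional, hence the default value outside the index range.\<close>
    define y where "y = (\<lambda>j. if j \<in> {1..n} then (1 + t) * x j - (if j = i then t else 0) else undefined)"
    have nn: "0 \<le> y j" if "j \<in> {1..n}" for j
    proof -
      have "0 \<le> x j" using x that by (auto simp: std_simplex_def)
      moreover have tx: "0 \<le> t * x i" using t pos by simp
      ultimately have "0 \<le> (1 + t) * x j - (if j = i then t else 0)"
      proof (cases "j = i")
        case True
        have "(1 + t) * x i = x i + t * x i" by (simp add: distrib_right)
        with t tx have "t \<le> (1 + t) * x i" by linarith
        with True show ?thesis by simp
      qed (use t in simp)
      then show ?thesis using that by (simp add: y_def)
    qed
    have "(\<Sum>j=1..n. y j) = (\<Sum>j=1..n. (1 + t) * x j) - (\<Sum>j=1..n. if j = i then t else 0)"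
      by (simp add: y_def sum_subtractf)
    also have "\<dots> = 1"
      using x i by (simp add: std_simplex_def flip: sum_distrib_left)
    finally have "y \<in> std_simplex n"
      using nn by (auto simp: std_simplex_def y_def)
    from le[OF this] have "L \<le> (1 + t)\<^sup>2 * L - 2 * (1 + t) * t * R + t\<^sup>2 * q i i"
      using quad_form_shift[where y = y and s = "1 + t" and x = x and t = t and q = q, OF i sym] by (simp add: y_def L_def R_def)
    then have "0 \<le> t * (2 * (L - R) + t * (L - 2 * R + q i i))"
      by (simp add: algebra_simps power2_eq_square)
    then show ?thesis using t by (simp add: zero_le_mult_iff)
  qed
  have "((\<lambda>t. 2 * (L - R) + t * (L - 2 * R + q i i)) \<longlongrightarrow> 2 * (L - R) + 0 * (L - 2 * R + q i i)) (at_right 0)"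
    by (intro tendsto_intros)
  moreover have "eventually (\<lambda>t. 0 \<le> 2 * (L - R) + t * (L - 2 * R + q i i)) (at_right 0)"
    unfolding eventually_at_right_field using pos ge by (intro exI[of _ "x i"]) auto
  ultimately have "0 \<le> 2 * (L - R) + 0 * (L - 2 * R + q i i)"
    by (intro tendsto_lowerbound) auto
  then show ?thesis by (simp add: L_def R_def)
qed

text \<open>
  Averaging the previous inequality over the support with \<^emph>\<open>equal\<close> weights, and using the symmetry of the
  matrix to exchange the roles of rows and columns, turns it into an average with weights \<open>x j\<close> of the
  unweighted row sums over the support. So some row is light, and the unknown weights have gone.
\<close>
lemma minimizer_light_row:
  assumes min: "is_global_minimizer n q x"
    and sym: "\<And>a b. a \<in> {1..n} \<Longrightarrow> b \<in> {1..n} \<Longrightarrow> q a b = q b a"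
    and I: "I = {j \<in> {1..n}. x j > 0}"
  shows "\<exists>j\<in>I. (\<Sum>i\<in>I. q j i) \<le> real (card I) * quad_form n q x"
proof (rule ccontr)
  assume neg: "\<not> ?thesis"
  define L where "L = quad_form n q x"
  have x: "x \<in> std_simplex n"
    using min unfolding is_global_minimizer_def is_arg_min_linorder by auto
  have x0: "x j = 0" if "j \<in> {1..n} - I" for j
    using x that I by (force simp: std_simplex_def)
  have IS: "I \<subseteq> {1..n}" "finite I" unfolding I by auto
  have onI: "(\<Sum>j=1..n. g j * x j) = (\<Sum>j\<in>I. g j * x j)" for g
    using IS x0 by (intro sum.mono_neutral_right) auto
  have sum1: "(\<Sum>j\<in>I. x j) = 1"
    using onI[of "\<lambda>_. 1"] x by (simp add: std_simplex_def)
  then have ne: "I \<noteq> {}" by auto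
  have "real (card I) * L = (\<Sum>j\<in>I. (real (card I) * L) * x j)"
    by (simp add: sum1 flip: sum_distrib_left)
  also have "\<dots> < (\<Sum>j\<in>I. (\<Sum>i\<in>I. q j i) * x j)"
    using neg ne IS by (intro sum_strict_mono) (auto simp: I L_def not_le)
  also have "\<dots> = (\<Sum>i\<in>I. \<Sum>j\<in>I. q i j * x j)"
    using sym IS by (subst sum.swap) (auto simp: sum_distrib_right subset_iff intro!: sum.cong)
  also have "\<dots> = (\<Sum>i\<in>I. \<Sum>j=1..n. q i j * x j)"
    by (simp only: onI)
  also have "\<dots> \<le> (\<Sum>i\<in>I. L)"
    using minimizer_row_le_value[OF min _ _ sym] by (intro sum_mono) (auto simp: I L_def)
  also have "\<dots> = real (card I) * L" by simp
  finally show False by simp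
qed

section \<open>The smallest entries of a row\<close>

text \<open>
  A set \<open>J\<close> of \<open>m\<close> entries is traded for the \<open>m'\<close> smallest entries of all. Their average is no larger, as
  everything outside the list exceeds its last element. Moreover at least \<open>m - m' + 1\<close> elements of \<open>J\<close> are at
  least as large as that last element, so giving up a few entries forces the remaining ones to be small
  individually and not just on average.
\<close>
lemma smallest_entries:
  fixes z :: "'b :: linorder \<Rightarrow> real"
  assumes S: "finite S" and J: "J \<subseteq> S" "card J = m" and m': "0 < m'" "m' \<le> m"
  obtains xs where "distinct xs" "set xs \<subseteq> S" "length xs = m'" "sorted (map z xs)"
    "\<And>i. i \<in> S - set xs \<Longrightarrow> z (last xs) \<le> z i"
    "real m * (\<Sum>i\<in>set xs. z i) \<le> real m' * (\<Sum>i\<in>J. z i)"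
    "(\<And>i. i \<in> J \<Longrightarrow> 0 \<le> z i) \<Longrightarrow> real (m - m' + 1) * z (last xs) \<le> (\<Sum>i\<in>J. z i)"
proof -
  define ys where "ys = sort_key z (sorted_list_of_set S)"
  define xs where "xs = take m' ys"
  define w where "w = z (last xs)"
  have ys: "distinct ys" "set ys = S" "length ys = card S" "sorted (map z ys)"
    using S by (auto simp: ys_def)
  have "card J \<le> card S" using S J by (intro card_mono)
  then have len: "length xs = m'" using ys J m' by (simp add: xs_def)
  have xs: "distinct xs" "set xs \<subseteq> S" "sorted (map z xs)"
    using ys set_take_subset[of m' ys] by (auto simp: xs_def take_map[symmetric] sorted_wrt_take)
  have ne: "xs \<noteq> []" using len m' by auto
  have app: "ys = xs @ drop m' ys" by (simp add: xs_def)
  have out: "w \<le> z i" if "i \<in> S - set xs" for i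
  proof -
    have "i \<in> set (drop m' ys)" using that ys(2) app by (metis DiffE Un_iff set_append)
    moreover have "sorted (map z xs @ map z (drop m' ys))"
      using ys(4) app by (metis map_append)
    ultimately show ?thesis using ne by (auto simp: sorted_append w_def)
  qed
  have ins: "z i \<le> w" if "i \<in> set xs" for i
  proof -
    have "xs = butlast xs @ [last xs]" using ne by simp
    then have "sorted (map z (butlast xs) @ [w])" using xs(3) unfolding w_def
      by (metis list.simps(8,9) map_append)
    moreover have "i \<in> set (butlast xs) \<or> i = last xs"
      using that \<open>xs = butlast xs @ [last xs]\<close> by (metis in_set_butlastD insert_iff list.set(2) rotate1.simps(2) set_rotate1)
    ultimately show ?thesis by (auto simp: sorted_append w_def)
  qed
  have fJ: "finite J" using J S finite_subset by blast
  define a where "a = card (J \<inter> set xs)"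
  define C where "C = (\<Sum>i\<in>J \<inter> set xs. z i)"
  have cx: "card (set xs) = m'" using xs len by (simp add: distinct_card)
  have aJ: "card (J - set xs) = m - a" "a \<le> m"
    using fJ J by (auto simp: a_def card_Diff_subset_Int intro: card_mono)
  have aX: "card (set xs - J) = m' - a" "a \<le> m'"
    using cx card_mono[of "set xs" "J \<inter> set xs"] by (auto simp: a_def card_Diff_subset_Int Int_commute)
  have sJ: "(\<Sum>i\<in>J. z i) = C + (\<Sum>i\<in>J - set xs. z i)"
    using fJ by (simp add: C_def sum.Int_Diff)
  have sX: "(\<Sum>i\<in>set xs. z i) = C + (\<Sum>i\<in>set xs - J. z i)"
    by (simp add: C_def Int_commute sum.Int_Diff[of "set xs" z J])
  have "(\<Sum>i\<in>J - set xs. w) \<le> (\<Sum>i\<in>J - set xs. z i)"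
    using out J by (intro sum_mono) auto
  then have geJ: "C + (real m - real a) * w \<le> (\<Sum>i\<in>J. z i)" using aJ sJ by (simp add: of_nat_diff)
  have "(\<Sum>i\<in>set xs - J. z i) \<le> (\<Sum>i\<in>set xs - J. w)"
    using ins by (intro sum_mono) auto
  then have leX: "(\<Sum>i\<in>set xs. z i) \<le> C + (real m' - real a) * w" using aX sX by (simp add: of_nat_diff)
  have "C \<le> (\<Sum>i\<in>J \<inter> set xs. w)" unfolding C_def using ins by (intro sum_mono) auto
  then have Ca: "C \<le> real a * w" by (simp add: a_def)
  have "real m * (\<Sum>i\<in>set xs. z i) \<le> real m * (C + (real m' - real a) * w)"
    using leX by (intro mult_left_mono) auto
  also have "\<dots> \<le> real m' * (C + (real m - real a) * w)"
    using mult_left_mono[OF Ca, of "real m - real m'"] m' by (simp add: algebra_simps)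
  also have "\<dots> \<le> real m' * (\<Sum>i\<in>J. z i)"
    using geJ by (intro mult_left_mono) auto
  finally have avg: "real m * (\<Sum>i\<in>set xs. z i) \<le> real m' * (\<Sum>i\<in>J. z i)" .
  have "real (m - m' + 1) * w \<le> (\<Sum>i\<in>J. z i)" if nn: "\<And>i. i \<in> J \<Longrightarrow> 0 \<le> z i"
  proof -
    \<comment> \<open>The last element itself counts among the large ones, so at most \<open>m' - 1\<close> elements are smaller.\<close>
    define X' where "X' = set xs - {last xs}"
    have cX': "card X' = m' - 1" using cx ne by (simp add: X'_def)
    have wl: "w \<le> z i" if "i \<in> J - X'" for i using that out J by (auto simp: X'_def w_def)
    have card: "m - m' + 1 \<le> card (J - X')"
      using diff_card_le_card_Diff[of X' J] J m' cX' by (simp add: X'_def)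
    show ?thesis
    proof (cases "0 \<le> w")
      case True
      have "real (m - m' + 1) * w \<le> real (card (J - X')) * w"
        using card True by (intro mult_right_mono) auto
      also have "\<dots> = (\<Sum>i\<in>J - X'. w)" by simp
      also have "\<dots> \<le> (\<Sum>i\<in>J - X'. z i)" using wl by (intro sum_mono) auto
      also have "\<dots> \<le> (\<Sum>i\<in>J. z i)" using fJ nn by (intro sum_mono2) auto
      finally show ?thesis .
    next
      case False
      then have "real (m - m' + 1) * w \<le> 0" by (intro mult_nonneg_nonpos) auto
      also have "0 \<le> (\<Sum>i\<in>J. z i)" using nn by (intro sum_nonneg) auto
      finally show ?thesis .
    qed
  qed
  with that[of xs] xs len out avg show ?thesis by (simp add: w_def)
qed

text \<open>
  For an increasing list \<open>u\<^sub>1 \<le> \<dots> \<le> u\<^sub>m\<close> (with \<open>u\<^sub>0 = 0\<close>), Abel summation turns this linear form into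
  \<open>\<Sum>l. (m - l + 1) powr \<mu> * (u\<^sub>l - u\<^sub>l\<^sub>-\<^sub>1)\<close>, in which the gaps appear with the weights that
  produce the factors \<open>1 + (l/m) powr \<mu>\<close> of the final product.
\<close>
fun wsum :: "real \<Rightarrow> real list \<Rightarrow> real" where
  "wsum \<mu> [] = 0"
| "wsum \<mu> (u # us) = (real (length us + 1) powr \<mu> - real (length us) powr \<mu>) * u + wsum \<mu> us"

lemma powr_increment_mono:
  fixes v :: real
  assumes \<nu>: "\<nu> \<ge> 1" and v: "v \<ge> 0" and S: "0 \<le> S" "S \<le> T"
  shows "(v + S) powr \<nu> - S powr \<nu> \<le> (v + T) powr \<nu> - T powr \<nu>"
proof (cases "S = 0 \<or> v = 0 \<or> S = T")
  case False
  then have pos: "0 < S" "0 < v" "S < T" using v S by auto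
  define g where "g = (\<lambda>s. (v + s) powr \<nu> - s powr \<nu>)"
  have "g S \<le> g T"
  proof (rule DERIV_nonneg_imp_nondecreasing[where f = g and a = S and b = T])
    show "S \<le> T" by fact
    fix s assume s: "S \<le> s" "s \<le> T"
    have "(g has_real_derivative \<nu> * (v + s) powr (\<nu> - 1) - \<nu> * s powr (\<nu> - 1)) (at s)"
      unfolding g_def using pos s by (auto intro!: derivative_eq_intros)
    moreover have "s powr (\<nu> - 1) \<le> (v + s) powr (\<nu> - 1)"
      using pos s \<nu> by (intro powr_mono2) auto
    ultimately show "\<exists>y. (g has_real_derivative y) (at s) \<and> 0 \<le> y"
      using \<nu> by (intro exI conjI) (auto simp: mult_left_mono)
  qed
  then show ?thesis by (simp add: g_def)
next
  case True
  have "v powr \<nu> + T powr \<nu> \<le> (v + T) powr \<nu>"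
  proof (cases "v + T = 0")
    case False
    then have p: "v + T > 0" using v S by auto
    have b: "y powr \<nu> \<le> y * (v + T) powr (\<nu> - 1)" if "0 \<le> y" "y \<le> v + T" for y
    proof (cases "y = 0")
      case False
      then have "y powr \<nu> = y * y powr (\<nu> - 1)" using that by (simp add: powr_diff)
      also have "\<dots> \<le> y * (v + T) powr (\<nu> - 1)"
        using that \<nu> by (intro mult_left_mono powr_mono2) auto
      finally show ?thesis .
    qed (use \<nu> in auto)
    have "v powr \<nu> + T powr \<nu> \<le> v * (v + T) powr (\<nu> - 1) + T * (v + T) powr (\<nu> - 1)"
      using b[of v] b[of T] v S by simp
    also have "\<dots> = (v + T) * (v + T) powr (\<nu> - 1)"
      by (simp only: distrib_right)
    also have "\<dots> = (v + T) powr \<nu>"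
      using p by (simp add: powr_diff)
    finally show ?thesis .
  next
    case True
    then have "v = 0" "T = 0" using v S by linarith+
    then show ?thesis by simp
  qed
  with True show ?thesis by auto
qed

text \<open>
  Prepending a smallest element \<open>v\<close> to a list of length \<open>r\<close> and sum \<open>S\<close> raises the right-hand side by
  \<open>(v + S) powr \<nu> - S powr \<nu>\<close>. This increases with \<open>S \<ge> r v\<close>, and at \<open>S = r v\<close> it equals the new term
  of the weighted sum.
\<close>
lemma sum_powr_ge_wsum:
  assumes \<nu>: "\<nu> \<ge> 1" and "sorted vs" and "\<And>v. v \<in> set vs \<Longrightarrow> v \<ge> 0"
  shows "wsum \<nu> (map (\<lambda>v. v powr \<nu>) vs) \<le> sum_list vs powr \<nu>"
  using assms(2,3)
proof (induction vs)
  case (Cons v vs)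
  define r where "r = real (length vs)"
  define S where "S = sum_list vs"
  have v: "0 \<le> v" using Cons by auto
  have "sum_list (map (\<lambda>_. v) vs) \<le> sum_list (map (\<lambda>x. x) vs)"
    using Cons.prems by (intro sum_list_mono) auto
  then have "r * v \<le> S" by (simp add: r_def S_def sum_list_triv)
  then have "(v + r * v) powr \<nu> - (r * v) powr \<nu> \<le> (v + S) powr \<nu> - S powr \<nu>"
    using \<nu> v by (intro powr_increment_mono) (auto simp: r_def)
  moreover have "(v + r * v) powr \<nu> = (r + 1) powr \<nu> * v powr \<nu>"
    using v by (simp add: r_def distrib_right flip: powr_mult) (simp add: algebra_simps)
  moreover have "(r * v) powr \<nu> = r powr \<nu> * v powr \<nu>"
    using v by (simp add: r_def powr_mult)
  moreover have "wsum \<nu> (map (\<lambda>v. v powr \<nu>) vs) \<le> S powr \<nu>"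
    using Cons by (simp add: S_def)
  ultimately show ?case
    by (simp add: S_def r_def algebra_simps)
qed simp

lemma wsum_1: "wsum 1 us = sum_list us"
  by (induction us) auto

text \<open>
  Jensen's inequality for the concave power, from Young's inequality applied to \<open>v / s\<close> with \<open>s\<close> the mean.
\<close>
lemma powr_mean_ge_mean_powr:
  fixes vs :: "real list"
  assumes \<nu>: "0 < \<nu>" "\<nu> \<le> 1" and nn: "\<And>v. v \<in> set vs \<Longrightarrow> v \<ge> 0" and ne: "vs \<noteq> []"
  shows "sum_list (map (\<lambda>v. v powr \<nu>) vs) / real (length vs) \<le> (sum_list vs / real (length vs)) powr \<nu>"
proof (cases "sum_list vs = 0")
  case True
  then have "\<forall>v\<in>set vs. v = 0"
    using nn by (subst (asm) sum_list_nonneg_eq_0_iff) auto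
  then have "sum_list (map (\<lambda>v. v powr \<nu>) vs) = 0" using \<nu> by (induction vs) auto
  with True show ?thesis by simp
next
  case False
  define s where "s = sum_list vs / real (length vs)"
  have "0 \<le> sum_list vs" using nn by (intro sum_list_nonneg) auto
  with False ne have s: "s > 0" by (simp add: s_def)
  have young: "v powr \<nu> \<le> s powr \<nu> * (\<nu> * (v / s) + (1 - \<nu>))" if "v \<in> set vs" for v
  proof (cases "v = 0")
    case False
    then have v: "v > 0" using nn[OF that] by simp
    have "(v / s) powr \<nu> * 1 powr (1 - \<nu>) \<le> \<nu> * (v / s) + (1 - \<nu>) * 1"
      using v s \<nu> by (intro Youngs_inequality_0) auto
    then have "s powr \<nu> * (v / s) powr \<nu> \<le> s powr \<nu> * (\<nu> * (v / s) + (1 - \<nu>))"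
      by (intro mult_left_mono) auto
    moreover have "s powr \<nu> * (v / s) powr \<nu> = v powr \<nu>"
      using v s by (simp flip: powr_mult)
    ultimately show ?thesis by simp
  qed (use \<nu> s in auto)
  have "sum_list (map (\<lambda>v. v powr \<nu>) vs) \<le> sum_list (map (\<lambda>v. s powr \<nu> * (\<nu> * (v / s) + (1 - \<nu>))) vs)"
    using young by (rule sum_list_mono)
  also have "\<dots> = s powr \<nu> * (\<nu> / s * sum_list vs + (1 - \<nu>) * real (length vs))"
    by (induction vs) (simp_all add: algebra_simps)
  also have "\<dots> = s powr \<nu> * real (length vs)"
    using s ne by (simp add: s_def field_simps)
  finally show ?thesis using ne by (simp add: s_def divide_le_eq)
qed

text \<open>
  For \<open>\<nu> \<le> 1\<close> the power mean dominates the plain mean of the powers, which is the weighted sum with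
  exponent \<open>1\<close>; for \<open>\<nu> \<ge> 1\<close> it only dominates the weighted sum with exponent \<open>\<nu>\<close>. This is where the exponent
  \<open>max \<nu> 1\<close> of the rate comes from.
\<close>
lemma powr_mean_ge_wsum:
  fixes vs :: "real list"
  assumes \<nu>: "0 < \<nu>" and "sorted vs" and "\<And>v. v \<in> set vs \<Longrightarrow> v \<ge> 0" and ne: "vs \<noteq> []"
  shows "wsum (max \<nu> 1) (map (\<lambda>v. v powr \<nu>) vs) / real (length vs) powr (max \<nu> 1)
     \<le> (sum_list vs / real (length vs)) powr \<nu>"
proof (cases "\<nu> \<le> 1")
  case True
  then show ?thesis using powr_mean_ge_mean_powr[OF \<nu> True assms(3) ne] ne
    by (simp add: max_def wsum_1)
next
  case False
  then have "wsum \<nu> (map (\<lambda>v. v powr \<nu>) vs) \<le> sum_list vs powr \<nu>"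
    using assms by (intro sum_powr_ge_wsum) auto
  moreover have "0 \<le> sum_list vs" using assms by (intro sum_list_nonneg) auto
  ultimately show ?thesis using False ne
    by (simp add: max_def powr_divide divide_right_mono)
qed

lemma wsum_mult: "wsum \<mu> (map (\<lambda>u. a * u) us) = a * wsum \<mu> us"
  by (induction us) (auto simp: algebra_simps)

section \<open>The rate as a Riemann sum and as a series\<close>

text \<open>
  The integrand increases, so the right-endpoint Riemann sum overestimates the integral.
\<close>
lemma sum_ln_ge_c_rate:
  assumes \<mu>: "\<mu> > 0" and m: "m > 0"
  shows "real m * c_rate \<mu> \<le> (\<Sum>l=1..m. ln (1 + (real l / real m) powr \<mu>))"
proof -
  define g where "g = (\<lambda>x::real. ln (1 + x powr \<mu>))"
  have mono: "g x \<le> g y" if "0 \<le> x" "x \<le> y" for x y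
    unfolding g_def using that \<mu> by (subst ln_le_cancel_iff) (auto simp: powr_mono2 add_pos_nonneg)
  have cont: "continuous_on {0..1} g" 
    unfolding g_def using \<mu> by (intro continuous_intros continuous_on_powr') (auto simp: add_nonneg_eq_0_iff)
  have int: "g integrable_on {a..b}" if "0 \<le> a" "b \<le> 1" for a b
    using that by (intro integrable_continuous_interval continuous_on_subset[OF cont]) auto
  have "real m * integral {0..real j / real m} g \<le> (\<Sum>l=1..j. g (real l / real m))" if "j \<le> m" for j
    using that
  proof (induction j)
    case (Suc j)
    have "integral {0..real (Suc j) / real m} g =
        integral {0..real j / real m} g + integral {real j / real m..real (Suc j) / real m} g"
      using Suc.prems m by (intro Henstock_Kurzweil_Integration.integral_combine[symmetric] int) (auto simp: field_simps)
    moreover have "integral {real j / real m..real (Suc j) / real m} g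
        \<le> integral {real j / real m..real (Suc j) / real m} (\<lambda>_. g (real (Suc j) / real m))"
    proof (rule integral_le)
      show "g integrable_on {real j / real m..real (Suc j) / real m}"
        using Suc.prems m by (intro int) (auto simp: field_simps)
      fix x assume x: "x \<in> {real j / real m..real (Suc j) / real m}"
      then have "0 \<le> x" using m by (auto intro: order_trans[rotated])
      with x show "g x \<le> g (real (Suc j) / real m)" by (intro mono) auto
    qed auto
    moreover have "integral {real j / real m..real (Suc j) / real m} (\<lambda>_. g (real (Suc j) / real m))
        = g (real (Suc j) / real m) / real m"
      using m by (simp add: field_simps)
    ultimately have "real m * integral {0..real (Suc j) / real m} g
        \<le> real m * (integral {0..real j / real m} g + g (real (Suc j) / real m) / real m)"
      by (intro mult_left_mono) auto
    also have "\<dots> = real m * integral {0..real j / real m} g + g (real (Suc j) / real m)"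
      using m by (simp add: distrib_left)
    finally show ?case using Suc by simp
  qed simp
  from this[of m] show ?thesis using m by (simp add: g_def c_rate_def)
qed

text \<open>
  The remainder has derivative \<open>(- s) ^ N / (1 + s)\<close> by the geometric sum. The crude bound by \<open>t ^ (N + 1)\<close>, which does
  not tend to \<open>0\<close> at \<open>t = 1\<close>, is enough because it is integrated afterwards.
\<close>
lemma ln_one_plus_partial_sum:
  fixes t :: real
  assumes t: "0 \<le> t" "t \<le> 1"
  shows "\<bar>ln (1 + t) - (\<Sum>j<N. (-1) ^ j * t ^ (j + 1) / real (j + 1))\<bar> \<le> t ^ (N + 1)"
proof (cases "t = 0")
  case False
  define R where "R = (\<lambda>s::real. ln (1 + s) - (\<Sum>j<N. (-1) ^ j * s ^ (j + 1) / real (j + 1)))"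
  have D: "(R has_real_derivative (- s) ^ N / (1 + s)) (at s)" if "0 \<le> s" for s
  proof -
    have "(R has_real_derivative (1 / (1 + s) - (\<Sum>j<N. (-1) ^ j * s ^ j))) (at s)"
    proof -
      have "((\<lambda>s. (-1) ^ j * s ^ (j + 1) / real (j + 1)) has_real_derivative (-1) ^ j * s ^ j) (at s)" for j
      proof -
        have "((\<lambda>s. ((-1) ^ j / real (j + 1)) * s ^ (j + 1)) has_real_derivative
            ((-1) ^ j / real (j + 1)) * (real (j + 1) * s ^ j)) (at s)"
          by (intro DERIV_cmult) (use DERIV_pow[of "j + 1" s] in simp)
        then show ?thesis by simp
      qed
      then show ?thesis
        unfolding R_def using that
        by (intro DERIV_diff DERIV_sum) (auto intro!: derivative_eq_intros)
    qed
    moreover have "(\<Sum>j<N. (-1) ^ j * s ^ j) = (1 - (- s) ^ N) / (1 + s)"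
      using that geometric_sum[of "- s" N] by (simp flip: power_mult_distrib add: field_simps)
    ultimately show ?thesis by (simp flip: diff_divide_distrib)
  qed
  have "\<exists>\<xi>. 0 < \<xi> \<and> \<xi> < t \<and> R t - R 0 = (t - 0) * ((- \<xi>) ^ N / (1 + \<xi>))"
    using False t D by (intro MVT2) auto
  then obtain \<xi> where \<xi>: "0 < \<xi>" "\<xi> < t" "R t - R 0 = (t - 0) * ((- \<xi>) ^ N / (1 + \<xi>))" by blast
  moreover have "R 0 = 0" by (simp add: R_def)
  ultimately have "\<bar>R t\<bar> = t * (\<xi> ^ N / (1 + \<xi>))" using t by (simp add: abs_mult power_abs)
  also have "\<dots> \<le> t * (t ^ N / 1)"
    using \<xi> t by (intro mult_left_mono frac_le power_mono) auto
  finally show ?thesis by (simp add: R_def)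
qed simp

lemma c_rate_sums:
  assumes \<mu>: "\<mu> > 0"
  shows "(\<lambda>j. (-1) ^ j / (real (j + 1) * (real (j + 1) * \<mu> + 1))) sums c_rate \<mu>"
proof -
  define a where "a = (\<lambda>j. (-1) ^ j / (real (j + 1) * (real (j + 1) * \<mu> + 1)))"
  define g where "g = (\<lambda>x::real. ln (1 + x powr \<mu>))"
  have pw: "((\<lambda>x. (x powr \<mu>) ^ (j + 1)) has_integral 1 / (real (j + 1) * \<mu> + 1)) {0..1}" for j
  proof -
    have "0 < real (j + 1) * \<mu>" using \<mu> by simp
    then have "((\<lambda>x. x powr (real (j + 1) * \<mu>)) has_integral 1 / (real (j + 1) * \<mu> + 1)) {0..1}"
      using has_integral_powr_from_0[of "real (j + 1) * \<mu>" 1] by simp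
    then show ?thesis
    proof (rule has_integral_eq[rotated])
      fix x :: real
      show "x powr (real (j + 1) * \<mu>) = (x powr \<mu>) ^ (j + 1)"
      proof (cases "x = 0")
        case False
        then show ?thesis by (rule powr_power[symmetric])
      qed simp
    qed
  qed
  have cont: "continuous_on {0..1} g" 
    unfolding g_def using \<mu> by (intro continuous_intros continuous_on_powr') (auto simp: add_nonneg_eq_0_iff)
  have bound: "\<bar>c_rate \<mu> - (\<Sum>j<N. a j)\<bar> \<le> 1 / (real (N + 1) * \<mu> + 1)" for N
  proof -
    define p where "p = (\<lambda>x. \<Sum>j<N. (-1) ^ j * (x powr \<mu>) ^ (j + 1) / real (j + 1))"
    have "((\<lambda>x. \<Sum>j<N. ((-1) ^ j / real (j + 1)) * (x powr \<mu>) ^ (j + 1)) has_integral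
        (\<Sum>j<N. ((-1) ^ j / real (j + 1)) * (1 / (real (j + 1) * \<mu> + 1)))) {0..1}"
      by (intro has_integral_sum has_integral_mult_right pw) auto
    then have p: "(p has_integral (\<Sum>j<N. a j)) {0..1}"
      by (simp add: p_def a_def)
    have gi: "(g has_integral c_rate \<mu>) {0..1}"
      using integrable_continuous_interval[OF cont] by (simp add: c_rate_def g_def has_integral_integral)
    have gp: "((\<lambda>x. g x - p x) has_integral c_rate \<mu> - (\<Sum>j<N. a j)) {0..1}"
      using gi p by (rule has_integral_diff)
    have "norm (integral {0..1} (\<lambda>x. g x - p x)) \<le> integral {0..1} (\<lambda>x. (x powr \<mu>) ^ (N + 1))"
    proof (rule integral_norm_bound_integral)
      fix x :: real assume x: "x \<in> {0..1}"
      then show "norm (g x - p x) \<le> (x powr \<mu>) ^ (N + 1)"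
        unfolding g_def p_def real_norm_def using \<mu>
        by (intro ln_one_plus_partial_sum) (auto simp: powr_le1)
    qed (use gp pw[of N] in blast)+
    then show ?thesis using gp pw[of N] by (simp only: integral_unique real_norm_def)
  qed
  have "(\<lambda>N. 1 / (real (N + 1) * \<mu> + 1)) \<longlonglongrightarrow> 0"
    using \<mu> by real_asymp
  then have "(\<lambda>N. c_rate \<mu> - (\<Sum>j<N. a j)) \<longlonglongrightarrow> 0"
    by (rule Lim_null_comparison[rotated]) (use bound in auto)
  then have "(\<lambda>N. \<Sum>j<N. a j) \<longlonglongrightarrow> c_rate \<mu>"
    using tendsto_diff[OF tendsto_const[of "c_rate \<mu>"]] by fastforce
  then show ?thesis by (simp add: sums_def a_def)
qed

section \<open>Reduction to uniform variables\<close>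

definition unif :: "real measure" where
  "unif = uniform_measure lborel {0..1}"

lemma prob_space_unif: "prob_space unif"
  unfolding unif_def by (intro prob_space_uniform_measure) auto

lemma sets_unif [simp, measurable_cong]: "sets unif = sets borel"
  by (simp add: unif_def)

lemma space_unif [simp]: "space unif = UNIV"
  by (simp add: unif_def)

lemma emeasure_unif: "A \<in> sets borel \<Longrightarrow> emeasure unif A = emeasure lborel ({0..1} \<inter> A)"
  by (simp add: unif_def divide_ennreal_def)

lemma product_unif: "product_prob_space (\<lambda>_. unif)"
  unfolding product_prob_space_def product_sigma_finite_def product_prob_space_axioms_def
  using prob_space_unif by (auto intro: prob_space_imp_sigma_finite)

lemma emeasure_unif_atLeast: "emeasure unif {v..} \<le> ennreal (exp (- v))"
proof -
  consider "v < 0" | "0 \<le> v" "v \<le> 1" | "1 < v" by linarith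
  then show ?thesis
  proof cases
    case 1
    have "emeasure unif {v..} \<le> 1"
      using prob_space.emeasure_le_1[OF prob_space_unif] by auto
    also have "1 \<le> ennreal (exp (- v))" using 1 by simp
    finally show ?thesis .
  next
    case 2
    then have "{0..1} \<inter> {v..} = {v..1}" by auto
    moreover have "1 - v \<le> exp (- v)" using exp_ge_add_one_self[of "- v"] by simp
    ultimately show ?thesis using 2 by (simp add: emeasure_unif ennreal_leI)
  next
    case 3
    then have "{0..1} \<inter> {v..} = {}" by auto
    then show ?thesis by (simp add: emeasure_unif)
  qed
qed

lemma emeasure_unif_atMost: "0 \<le> p \<Longrightarrow> emeasure unif {..p} \<le> ennreal p"
proof -
  assume p: "0 \<le> p"
  have "emeasure unif {..p} \<le> emeasure lborel {0..p}"
    unfolding emeasure_unif[of "{..p}", simplified] by (intro emeasure_mono) auto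
  then show ?thesis using p by simp
qed

lemma nn_integral_unif_exp:
  assumes a: "a > 0"
  shows "(\<integral>\<^sup>+ y. indicator {v..} y * ennreal (exp (- (a * y))) \<partial>unif) \<le> ennreal (exp (- (a * v)) / a)"
proof -
  have "(\<integral>\<^sup>+ y. indicator {v..} y * ennreal (exp (- (a * y))) \<partial>unif) =
      (\<integral>\<^sup>+ y. indicator {v..} y * ennreal (exp (- (a * y))) * indicator {0..1} y \<partial>lborel)"
    unfolding unif_def by (subst nn_integral_uniform_measure) (auto simp: divide_ennreal_def)
  also have "\<dots> \<le> (\<integral>\<^sup>+ y. ennreal (exp (- (a * y))) * indicator {v..} y \<partial>lborel)"
    by (intro nn_integral_mono) (auto split: split_indicator)
  also have "\<dots> = ennreal (0 - (- (exp (- (a * v)) / a)))"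
  proof (rule nn_integral_FTC_atLeast)
    show "((\<lambda>y. - (exp (- (a * y)) / a)) \<longlongrightarrow> 0) at_top"
      using a by real_asymp
    show "((\<lambda>y. - (exp (- (a * y)) / a)) has_real_derivative exp (- (a * y))) (at y)" for y
      using a by (auto intro!: derivative_eq_intros)
  qed auto
  finally show ?thesis by simp
qed

text \<open>
  \<open>F\<close> may be constant on intervals, so the events \<open>F X \<le> F x\<close> and \<open>X \<le> x\<close> need not coincide. The distribution function of
  \<open>F X\<close> at \<open>v\<close> is instead squeezed between \<open>v\<close> and every \<open>w > v\<close>.
\<close>
lemma (in prob_space) probability_integral_transform:
  assumes X [measurable]: "random_variable borel X"
    and F: "cdf (distr M borel X) = F" and cont: "continuous_on UNIV F"
  shows "distr M borel (\<lambda>\<omega>. F (X \<omega>)) = unif"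
proof -
  interpret D: real_distribution "distr M borel X" by (rule real_distribution_distr) fact
  have FP: "F x = prob {\<omega> \<in> space M. X \<omega> \<le> x}" for x
    unfolding F[symmetric] cdf_def by (subst measure_distr) (auto intro!: arg_cong[of _ _ prob])
  have mono: "F x \<le> F y" if "x \<le> y" for x y
    unfolding F[symmetric] by (rule D.cdf_nondecreasing) fact
  have [measurable]: "F \<in> borel_measurable borel"
    using cont by (rule borel_measurable_continuous_onI)
  have lims: "(F \<longlongrightarrow> 0) at_bot" "(F \<longlongrightarrow> 1) at_top"
    using D.cdf_lim_at_bot D.cdf_lim_at_top_prob by (simp_all add: F)
  have surj: "\<exists>x. F x = v" if v: "0 < v" "v < 1" for v
  proof -
    from order_tendstoD(2)[OF lims(1) v(1)] obtain a where a: "F a < v"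
      by (auto simp: eventually_at_bot_linorder)
    from order_tendstoD(1)[OF lims(2) v(2)] obtain b where b: "v < F b"
      by (auto simp: eventually_at_top_linorder)
    have "a \<le> b" using a b mono[of b a] by (cases "a \<le> b") auto
    then show ?thesis
      using IVT'[of F a v b] a b continuous_on_subset[OF cont] by auto
  qed
  have lower: "v \<le> prob {\<omega> \<in> space M. F (X \<omega>) \<le> v}" if v: "0 < v" "v < 1" for v
  proof -
    from surj[OF v] obtain x where x: "F x = v" by blast
    have "F x \<le> prob {\<omega> \<in> space M. F (X \<omega>) \<le> v}"
      unfolding FP[of x] by (intro finite_measure_mono) (use mono x in auto)
    with x show ?thesis by simp
  qed
  have upper: "prob {\<omega> \<in> space M. F (X \<omega>) \<le> v} \<le> w" if v: "v < w" "0 < w" "w < 1" for v w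
  proof -
    from surj[OF v(2,3)] obtain x where x: "F x = w" by blast
    have "X \<omega> \<le> x" if "F (X \<omega>) \<le> v" for \<omega>
      using mono[of x "X \<omega>"] that v x by (cases "X \<omega> \<le> x") auto
    then have "prob {\<omega> \<in> space M. F (X \<omega>) \<le> v} \<le> F x"
      unfolding FP[of x] by (intro finite_measure_mono) auto
    with x show ?thesis by simp
  qed
  show ?thesis
  proof (rule cdf_unique)
    show "real_distribution (distr M borel (\<lambda>\<omega>. F (X \<omega>)))"
      by (rule real_distribution_distr) measurable
    show "real_distribution unif"
      using prob_space_unif by (auto simp: real_distribution_def real_distribution_axioms_def)
    show "cdf (distr M borel (\<lambda>\<omega>. F (X \<omega>))) = cdf unif"
    proof
      fix v
      have l: "cdf (distr M borel (\<lambda>\<omega>. F (X \<omega>))) v = prob {\<omega> \<in> space M. F (X \<omega>) \<le> v}"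
        unfolding cdf_def by (subst measure_distr) (auto intro!: arg_cong[of _ _ prob])
      have r: "cdf unif v = measure lborel ({0..1} \<inter> {..v})"
        unfolding cdf_def measure_def by (simp add: emeasure_unif)
      have F01: "0 \<le> F x" "F x \<le> 1" for x unfolding FP by auto
      consider "v < 0" | "v = 0" | "0 < v" "v < 1" | "1 \<le> v" by linarith
      then show "cdf (distr M borel (\<lambda>\<omega>. F (X \<omega>))) v = cdf unif v"
      proof cases
        case 1
        then have "\<not> F x \<le> v" for x using F01(1)[of x] by simp
        moreover have "{0..1} \<inter> {..v} = {}" using 1 by auto
        ultimately show ?thesis unfolding l r by simp
      next
        case 2
        have "prob {\<omega> \<in> space M. F (X \<omega>) \<le> v} \<le> 0"
        proof (rule dense_ge_bounded[of 0 "1 :: real"])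
          show "prob {\<omega> \<in> space M. F (X \<omega>) \<le> v} \<le> w" if "0 < w" "w < 1" for w
            using upper[of v w] that 2 by simp
        qed simp
        then have "prob {\<omega> \<in> space M. F (X \<omega>) \<le> v} = 0" using measure_nonneg[of M] by (simp add: antisym)
        moreover have "{0..1} \<inter> {..v} = {0}" using 2 by auto
        ultimately show ?thesis unfolding l r by simp
      next
        case 3
        have "prob {\<omega> \<in> space M. F (X \<omega>) \<le> v} \<le> v"
        proof (rule dense_ge_bounded[OF 3(2)])
          show "prob {\<omega> \<in> space M. F (X \<omega>) \<le> v} \<le> w" if "v < w" "w < 1" for w
            using upper[of v w] that 3 by simp
        qed
        moreover have "{0..1} \<inter> {..v} = {0..v}" using 3 by auto
        ultimately show ?thesis unfolding l r using lower[OF 3] 3 by simp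
      next
        case 4
        then have "{\<omega> \<in> space M. F (X \<omega>) \<le> v} = space M" using F01(2) order_trans by blast
        moreover have "{0..1} \<inter> {..v} = {0..1}" using 4 by auto
        ultimately show ?thesis unfolding l r by (simp add: prob_space)
      qed
    qed
  qed
qed

section \<open>Probability that one row is light\<close>

lemma component_measurable: "i \<in> I \<Longrightarrow> (\<lambda>x. x i) \<in> borel_measurable (PiM I (\<lambda>_. unif))"
  using measurable_component_singleton[of i I "\<lambda>_. unif"] by (simp cong: measurable_cong_sets)

lemma pred_le:
  fixes f g :: "'a \<Rightarrow> real"
  assumes [measurable]: "f \<in> borel_measurable M" "g \<in> borel_measurable M"
  shows "Measurable.pred M (\<lambda>x. f x \<le> g x)"
  by measurable

lemma wsum_measurable:
  "(\<And>i. i \<in> set xs \<Longrightarrow> f i \<in> borel_measurable M) \<Longrightarrow> (\<lambda>x. wsum \<mu> (map (\<lambda>i. f i x) xs)) \<in> borel_measurable M"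
proof (induction xs)
  case (Cons i xs)
  then have [measurable]: "f i \<in> borel_measurable M" "(\<lambda>x. wsum \<mu> (map (\<lambda>i. f i x) xs)) \<in> borel_measurable M" by auto
  show ?case by simp
qed simp

lemma last_measurable:
  "(\<And>i. i \<in> set xs \<Longrightarrow> f i \<in> borel_measurable M) \<Longrightarrow> (\<lambda>x. last (v # map (\<lambda>i. f i x) xs) :: real) \<in> borel_measurable M"
  by (cases "xs = []") (simp_all add: last_map)

lemma sorted_measurable:
  fixes f :: "'i \<Rightarrow> 'a \<Rightarrow> real"
  assumes "v \<in> borel_measurable M" and "\<And>i. i \<in> set xs \<Longrightarrow> f i \<in> borel_measurable M"
  shows "Measurable.pred M (\<lambda>x. sorted (v x # map (\<lambda>i. f i x) xs))"
  using assms
proof (induction xs arbitrary: v)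
  case (Cons i xs)
  have "(\<lambda>x. sorted (v x # map (\<lambda>i. f i x) (i # xs))) = (\<lambda>x. v x \<le> f i x \<and> sorted (f i x # map (\<lambda>i. f i x) xs))"
    by (auto simp: fun_eq_iff)
  moreover have "Measurable.pred M (\<lambda>x. v x \<le> f i x \<and> sorted (f i x # map (\<lambda>i. f i x) xs))"
    using Cons.prems by (intro pred_intros_logic pred_le Cons.IH) auto
  ultimately show ?case by (simp only:)
qed simp

text \<open>
  \<open>y\<close> assigns a uniform value to every matrix entry. The list \<open>xs\<close> holds the smallest off-diagonal entries
  of a row in increasing order, \<open>R\<close> the other off-diagonal entries of that row, \<open>a\<close> its diagonal entry, and \<open>W\<close> the
  remaining diagonal entries. Prepending \<open>0\<close> builds in nonnegativity and gives the last entry a meaning for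
  the empty list.
\<close>
definition light_row ::
    "real \<Rightarrow> real \<Rightarrow> real \<Rightarrow> 'i \<Rightarrow> 'i list \<Rightarrow> 'i set \<Rightarrow> 'i set \<Rightarrow> ('i \<Rightarrow> real) \<Rightarrow> bool" where
  "light_row \<mu> D p a xs R W y \<longleftrightarrow>
     sorted (0 # map y xs) \<and> (\<forall>r\<in>R. last (0 # map y xs) \<le> y r) \<and>
     (\<forall>w\<in>W. D * wsum \<mu> (map y xs) \<le> y w) \<and> y a \<le> p"

lemma light_row_measurable:
  fixes f :: "'i \<Rightarrow> 'a \<Rightarrow> real"
  assumes f: "\<And>i. i \<in> insert a (set xs \<union> R \<union> W) \<Longrightarrow> f i \<in> borel_measurable M"
    and fin: "finite R" "finite W"
  shows "Measurable.pred M (\<lambda>x. light_row \<mu> D p a xs R W (\<lambda>i. f i x))"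
  unfolding light_row_def
  by (intro pred_intros_logic pred_intros_finite fin pred_le sorted_measurable last_measurable
      borel_measurable_times wsum_measurable borel_measurable_const f) auto

text \<open>
  Integrate over the first variable of the chain last. In terms of the gaps of the chain the exponent is a sum
  in which the gap below the \<open>l\<close>-th variable from the end has the coefficient \<open>D * l powr \<mu> + E\<close>, so each
  integration contributes one reciprocal factor. The free lower end \<open>v\<close> makes the induction work.
\<close>
lemma chain_integral:
  assumes D: "D \<ge> 0" and E: "E > 0" and \<mu>: "\<mu> > 0" and "distinct xs"
  shows "(\<integral>\<^sup>+ x. indicator {x. sorted (v # map x xs)} x *
        ennreal (exp (- (E * last (v # map x xs) + D * wsum \<mu> (map x xs)))) \<partial>PiM (set xs) (\<lambda>_. unif))
     \<le> ennreal (exp (- ((D * real (length xs) powr \<mu> + E) * v)) / (\<Prod>l=1..length xs. D * real l powr \<mu> + E))"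
  using assms(4)
proof (induction xs arbitrary: v)
  case Nil
  then show ?case by (simp add: PiM_empty nn_integral_count_space_finite)
next
  case (Cons i xs)
  interpret product_prob_space "\<lambda>_. unif" by (rule product_unif)
  define r where "r = length xs"
  define P where "P = (\<Prod>l=1..r. D * real l powr \<mu> + E)"
  define a where "a = D * real (Suc r) powr \<mu> + E"
  define b where "b = D * (real (Suc r) powr \<mu> - real r powr \<mu>)"
  define h where "h = (\<lambda>v x. indicator {x. sorted (v # map x xs)} x *
        ennreal (exp (- (E * last (v # map x xs) + D * wsum \<mu> (map x xs)))))"
  have P: "P > 0" unfolding P_def using D E by (intro prod_pos) (auto intro: add_nonneg_pos)
  have a: "a > 0" unfolding a_def using D E by (auto intro: add_nonneg_pos)
  let ?f = "\<lambda>x. indicator {x. sorted (v # map x (i # xs))} x *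
        ennreal (exp (- (E * last (v # map x (i # xs)) + D * wsum \<mu> (map x (i # xs)))))"
  have meas: "?f \<in> borel_measurable (PiM (insert i (set xs)) (\<lambda>_. unif))"
  proof -
    have [measurable]: "(\<lambda>x. wsum \<mu> (map x (i # xs))) \<in> borel_measurable (PiM (insert i (set xs)) (\<lambda>_. unif))"
      by (intro wsum_measurable component_measurable) auto
    have [measurable]: "(\<lambda>x. last (v # map x (i # xs))) \<in> borel_measurable (PiM (insert i (set xs)) (\<lambda>_. unif))"
      by (intro last_measurable component_measurable) auto
    have [measurable]: "Measurable.pred (PiM (insert i (set xs)) (\<lambda>_. unif)) (\<lambda>x. sorted (v # map x (i # xs)))"
      by (intro sorted_measurable component_measurable) auto
    have "?f = (\<lambda>x. if sorted (v # map x (i # xs)) then 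
        ennreal (exp (- (E * last (v # map x (i # xs)) + D * wsum \<mu> (map x (i # xs))))) else 0)"
      by (auto simp: fun_eq_iff split: split_indicator)
    also have "\<dots> \<in> borel_measurable (PiM (insert i (set xs)) (\<lambda>_. unif))"
      by measurable
    finally show ?thesis .
  qed
  have hm: "h y \<in> borel_measurable (PiM (set xs) (\<lambda>_. unif))" for y
  proof -
    have [measurable]: "(\<lambda>x. wsum \<mu> (map x xs)) \<in> borel_measurable (PiM (set xs) (\<lambda>_. unif))"
      by (intro wsum_measurable component_measurable) auto
    have [measurable]: "(\<lambda>x. last (y # map x xs)) \<in> borel_measurable (PiM (set xs) (\<lambda>_. unif))"
      by (intro last_measurable component_measurable) auto
    have [measurable]: "Measurable.pred (PiM (set xs) (\<lambda>_. unif)) (\<lambda>x. sorted (y # map x xs))"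
      by (intro sorted_measurable component_measurable) auto
    have "h y = (\<lambda>x. if sorted (y # map x xs) then 
        ennreal (exp (- (E * last (y # map x xs) + D * wsum \<mu> (map x xs)))) else 0)"
      by (auto simp: h_def fun_eq_iff split: split_indicator)
    also have "\<dots> \<in> borel_measurable (PiM (set xs) (\<lambda>_. unif))"
      by measurable
    finally show ?thesis .
  qed
  have split: "?f (x(i := y)) = indicator {v..} y * ennreal (exp (- (b * y))) * h y x" for x y
  proof -
    have m: "map (x(i := y)) xs = map x xs" using Cons.prems by (intro map_cong) auto
    have e1: "ennreal (exp (- (E * last (v # map (x(i := y)) (i # xs)) + D * wsum \<mu> (map (x(i := y)) (i # xs)))))
      = ennreal (exp (- (b * y))) * ennreal (exp (- (E * last (y # map x xs) + D * wsum \<mu> (map x xs))))"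
      by (simp add: m b_def r_def algebra_simps flip: ennreal_mult exp_add)
    have e2: "sorted (v # map (x(i := y)) (i # xs)) \<longleftrightarrow> v \<le> y \<and> sorted (y # map x xs)"
      by (simp only: list.map fun_upd_same m) auto
    show ?thesis
      by (simp only: h_def indicator_def mem_Collect_eq atLeast_iff e1 e2) simp
  qed
  have "integral\<^sup>N (PiM (set (i # xs)) (\<lambda>_. unif)) ?f
      = (\<integral>\<^sup>+ y. (\<integral>\<^sup>+ x. indicator {v..} y * ennreal (exp (- (b * y))) * h y x \<partial>PiM (set xs) (\<lambda>_. unif)) \<partial>unif)"
  proof -
    have "integral\<^sup>N (PiM (insert i (set xs)) (\<lambda>_. unif)) ?f
        = (\<integral>\<^sup>+ y. (\<integral>\<^sup>+ x. ?f (x(i := y)) \<partial>PiM (set xs) (\<lambda>_. unif)) \<partial>unif)"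
      using Cons.prems by (intro product_nn_integral_insert_rev meas) auto
    then show ?thesis by (simp only: split list.set)
  qed
  also have "\<dots> = (\<integral>\<^sup>+ y. indicator {v..} y * ennreal (exp (- (b * y))) * (\<integral>\<^sup>+ x. h y x \<partial>PiM (set xs) (\<lambda>_. unif)) \<partial>unif)"
    by (intro nn_integral_cong nn_integral_cmult hm)
  also have "\<dots> \<le> (\<integral>\<^sup>+ y. indicator {v..} y * ennreal (exp (- (b * y))) *
        ennreal (exp (- ((D * real r powr \<mu> + E) * y)) / P) \<partial>unif)"
    using Cons.IH Cons.prems unfolding h_def P_def r_def
    by (intro nn_integral_mono mult_left_mono) auto
  also have "\<dots> = (\<integral>\<^sup>+ y. ennreal (1 / P) * (indicator {v..} y * ennreal (exp (- (a * y)))) \<partial>unif)"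
  proof (intro nn_integral_cong)
    fix y
    have "exp (- (b * y)) * (exp (- ((D * real r powr \<mu> + E) * y)) / P) = 1 / P * exp (- (a * y))"
      by (simp add: a_def b_def algebra_simps flip: exp_add)
    then show "indicator {v..} y * ennreal (exp (- (b * y))) * ennreal (exp (- ((D * real r powr \<mu> + E) * y)) / P)
       = ennreal (1 / P) * (indicator {v..} y * ennreal (exp (- (a * y))))"
      using P by (simp add: indicator_def flip: ennreal_mult)
  qed
  also have "\<dots> = ennreal (1 / P) * (\<integral>\<^sup>+ y. indicator {v..} y * ennreal (exp (- (a * y))) \<partial>unif)"
    by (intro nn_integral_cmult) measurable
  also have "\<dots> \<le> ennreal (1 / P) * ennreal (exp (- (a * v)) / a)"
    using a by (intro mult_left_mono nn_integral_unif_exp) auto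
  also have "\<dots> = ennreal (exp (- (a * v)) / (P * a))"
    using P a by (simp flip: ennreal_mult)
  also have "P * a = (\<Prod>l=1..length (i # xs). D * real l powr \<mu> + E)"
    by (simp add: P_def a_def r_def)
  finally show ?case by (simp add: a_def r_def)
qed

text \<open>
  Given the values along \<open>xs\<close>, the constraints on the other entries are independent. Bounding
  \<open>1 - u\<close> by \<open>exp (- u)\<close>, those on \<open>R\<close> contribute \<open>exp (- card R * last)\<close>, those on \<open>W\<close> contribute
  \<open>exp (- card W * D * wsum)\<close>, and the one on \<open>a\<close> contributes \<open>p\<close>. What remains is the chain integral.
\<close>
lemma (in prob_space) chain_event_prob:
  fixes Y :: "'i \<Rightarrow> 'a \<Rightarrow> real"
  assumes indep: "indep_vars (\<lambda>_. borel) Y K"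
    and unif: "\<And>i. i \<in> K \<Longrightarrow> distr M borel (Y i) = unif"
    and sub: "insert a (set xs \<union> R \<union> W) \<subseteq> K"
    and fin: "finite R" "finite W" and dist: "distinct xs"
    and disj: "a \<notin> R" "a \<notin> W" "R \<inter> W = {}" "set xs \<inter> insert a (R \<union> W) = {}"
    and p: "p \<ge> 0" and D: "D \<ge> 0" and R: "R \<noteq> {}" and \<mu>: "\<mu> > 0"
  shows "prob {\<omega> \<in> space M. light_row \<mu> D p a xs R W (\<lambda>i. Y i \<omega>)}
    \<le> p / (\<Prod>l=1..length xs. real (card W) * D * real l powr \<mu> + real (card R))"
proof -
  interpret U: product_prob_space "\<lambda>_. unif" by (rule product_unif)
  define I where "I = set xs"
  define J where "J = insert a (R \<union> W)"
  have IJ: "finite I" "finite J" "I \<inter> J = {}" "I \<union> J \<subseteq> K" "I \<union> J \<noteq> {}"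
    using sub fin disj by (auto simp: I_def J_def)
  let ?N = "PiM (I \<union> J) (\<lambda>_. unif)"
  have iv: "indep_vars (\<lambda>_. borel) Y (I \<union> J)"
    using indep_vars_subset[OF indep IJ(4)] .
  have rv: "random_variable borel (Y i)" if "i \<in> I \<union> J" for i
    using iv that by (auto simp: indep_vars_def)
  have "distr M (PiM (I \<union> J) (\<lambda>_. borel)) (\<lambda>\<omega>. \<lambda>i\<in>I \<union> J. Y i \<omega>) = PiM (I \<union> J) (\<lambda>i. distr M borel (Y i))"
    using iv by (subst (asm) indep_vars_iff_distr_eq_PiM'[OF IJ(5) rv]) auto
  also have "\<dots> = ?N"
    using IJ(4) unif by (intro PiM_cong) auto
  finally have law: "distr M (PiM (I \<union> J) (\<lambda>_. borel)) (\<lambda>\<omega>. \<lambda>i\<in>I \<union> J. Y i \<omega>) = ?N" .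
  have meas: "(\<lambda>\<omega>. \<lambda>i\<in>I \<union> J. Y i \<omega>) \<in> measurable M (PiM (I \<union> J) (\<lambda>_. borel))"
    using rv by (intro measurable_restrict) auto
  have setsN: "sets (PiM (I \<union> J) (\<lambda>_. borel)) = sets ?N"
    by (intro sets_PiM_cong) auto
  have spN: "space (PiM (I \<union> J) (\<lambda>_. borel)) = space ?N"
    by (simp add: space_PiM)
  define u where "u = (\<lambda>x::'i \<Rightarrow> real. last (0 # map x xs))"
  define s where "s = (\<lambda>x::'i \<Rightarrow> real. wsum \<mu> (map x xs))"
  define P where "P = light_row \<mu> D p a xs R W"
  have P_iff: "P x \<longleftrightarrow> sorted (0 # map x xs) \<and> (\<forall>r\<in>R. u x \<le> x r) \<and> (\<forall>w\<in>W. D * s x \<le> x w) \<and> x a \<le> p" for x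
    by (simp only: P_def light_row_def u_def s_def)
  have Pm: "Measurable.pred ?N P"
    unfolding P_def using fin
    by (intro light_row_measurable component_measurable) (auto simp: I_def J_def)
  have evP: "P (\<lambda>i\<in>I \<union> J. Y i \<omega>) \<longleftrightarrow> P (\<lambda>i. Y i \<omega>)" for \<omega>
  proof -
    have m: "map (\<lambda>i\<in>I \<union> J. Y i \<omega>) xs = map (\<lambda>i. Y i \<omega>) xs"
      by (intro map_cong) (auto simp: I_def)
    show ?thesis unfolding P_iff u_def s_def m by (auto simp: J_def)
  qed
  let ?Q = "real (card W) * D" and ?E = "real (card R)"
  have cR: "?E > 0" using R fin by (simp add: card_gt_0_iff)
  have inner: "(\<integral>\<^sup>+ y. indicator {x. P x} (merge I J (x, y)) \<partial>PiM J (\<lambda>_. unif))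
      \<le> ennreal p * (indicator {x. sorted (0 # map x xs)} x * ennreal (exp (- (?E * u x + ?Q * s x))))" for x
  proof -
    define B where "B = (\<lambda>j. if j = a then {..p} else if j \<in> R then {u x..} else {D * s x..})"
    have mI: "map (merge I J (x, y)) xs = map x xs" for y
      using IJ by (intro map_cong) (auto simp: I_def)
    have sub: "indicator {x. P x} (merge I J (x, y)) 
        \<le> indicator {x. sorted (0 # map x xs)} x * (indicator (Pi\<^sub>E J B) y :: ennreal)"
      if "y \<in> space (PiM J (\<lambda>_. unif))" for y
    proof (cases "P (merge I J (x, y))")
      case True
      have J: "j \<in> J \<Longrightarrow> merge I J (x, y) j = y j" for j using IJ(3) by auto
      have "sorted (0 # map x xs)" using True unfolding P_iff mI by blast
      moreover have "y j \<in> B j" if "j \<in> J" for j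
      proof -
        from True have "\<forall>r\<in>R. u x \<le> merge I J (x, y) r" "\<forall>w\<in>W. D * s x \<le> merge I J (x, y) w" "merge I J (x, y) a \<le> p"
          unfolding P_iff u_def s_def mI by blast+
        then show ?thesis using that J[of j] unfolding B_def by (auto simp: J_def)
      qed
      moreover have "y \<in> extensional J" using that by (simp add: space_PiM PiE_def)
      ultimately have "y \<in> Pi\<^sub>E J B" "sorted (0 # map x xs)" by (auto simp: PiE_def)
      then show ?thesis by (simp add: indicator_def)
    qed simp
    have Bm: "B j \<in> sets unif" for j by (simp add: B_def)
    have "(\<integral>\<^sup>+ y. indicator {x. P x} (merge I J (x, y)) \<partial>PiM J (\<lambda>_. unif))
       \<le> (\<integral>\<^sup>+ y. indicator {x. sorted (0 # map x xs)} x * indicator (Pi\<^sub>E J B) y \<partial>PiM J (\<lambda>_. unif))"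
      by (intro nn_integral_mono sub)
    also have "\<dots> = indicator {x. sorted (0 # map x xs)} x * emeasure (PiM J (\<lambda>_. unif)) (Pi\<^sub>E J B)"
      using Bm IJ by (subst nn_integral_cmult_indicator) auto
    also have "emeasure (PiM J (\<lambda>_. unif)) (Pi\<^sub>E J B) = (\<Prod>j\<in>J. emeasure unif (B j))"
      using Bm IJ by (intro U.emeasure_PiM) auto
    also have "\<dots> = emeasure unif {..p} * ((\<Prod>j\<in>R. emeasure unif {u x..}) * (\<Prod>j\<in>W. emeasure unif {D * s x..}))"
    proof -
      have "(\<Prod>j\<in>J. emeasure unif (B j)) = emeasure unif (B a) * ((\<Prod>j\<in>R. emeasure unif (B j)) * (\<Prod>j\<in>W. emeasure unif (B j)))"
        unfolding J_def using disj fin by (simp add: prod.union_disjoint)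
      moreover have "(\<Prod>j\<in>R. emeasure unif (B j)) = (\<Prod>j\<in>R. emeasure unif {u x..})"
        using disj by (intro prod.cong) (auto simp: B_def)
      moreover have "(\<Prod>j\<in>W. emeasure unif (B j)) = (\<Prod>j\<in>W. emeasure unif {D * s x..})"
        using disj by (intro prod.cong) (auto simp: B_def)
      ultimately show ?thesis by (simp add: B_def)
    qed
    also have "\<dots> \<le> ennreal p * ((\<Prod>j\<in>R. ennreal (exp (- u x))) * (\<Prod>j\<in>W. ennreal (exp (- (D * s x)))))"
      by (intro mult_mono prod_mono_ennreal emeasure_unif_atLeast emeasure_unif_atMost p) auto
    also have "(\<Prod>j\<in>R. ennreal (exp (- u x))) * (\<Prod>j\<in>W. ennreal (exp (- (D * s x)))) = ennreal (exp (- (?E * u x + ?Q * s x)))"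
      by (simp add: ennreal_power flip: ennreal_mult exp_add exp_of_nat_mult)
    finally show ?thesis
      by (simp add: mult_left_mono mult.left_commute)
  qed
  have "emeasure M {\<omega> \<in> space M. P (\<lambda>i. Y i \<omega>)} = emeasure ?N {x \<in> space ?N. P x}"
    unfolding law[symmetric] using meas Pm
    by (subst emeasure_distr) (auto simp: evP setsN spN cong: measurable_cong_sets intro!: arg_cong[of _ _ "emeasure M"] dest: measurable_space)
  also have "\<dots> = (\<integral>\<^sup>+ x. indicator {x. P x} x \<partial>?N)"
  proof -
    have "{x \<in> space ?N. P x} \<in> sets ?N" using Pm by measurable
    then have "emeasure ?N {x \<in> space ?N. P x} = (\<integral>\<^sup>+ x. indicator {x \<in> space ?N. P x} x \<partial>?N)"
      by (rule nn_integral_indicator[symmetric])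
    also have "\<dots> = (\<integral>\<^sup>+ x. indicator {x. P x} x \<partial>?N)"
      by (intro nn_integral_cong) (simp add: indicator_def)
    finally show ?thesis .
  qed
  also have "\<dots> = (\<integral>\<^sup>+ x. (\<integral>\<^sup>+ y. indicator {x. P x} (merge I J (x, y)) \<partial>PiM J (\<lambda>_. unif)) \<partial>PiM I (\<lambda>_. unif))"
    using Pm IJ by (intro U.product_nn_integral_fold) auto
  also have "\<dots> \<le> (\<integral>\<^sup>+ x. ennreal p * (indicator {x. sorted (0 # map x xs)} x * ennreal (exp (- (?E * u x + ?Q * s x)))) \<partial>PiM I (\<lambda>_. unif))"
    by (intro nn_integral_mono inner)
  also have "\<dots> = ennreal p * (\<integral>\<^sup>+ x. indicator {x. sorted (0 # map x xs)} x * ennreal (exp (- (?E * u x + ?Q * s x))) \<partial>PiM I (\<lambda>_. unif))"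
  proof (rule nn_integral_cmult)
    have [measurable]: "s \<in> borel_measurable (PiM I (\<lambda>_. unif))" "u \<in> borel_measurable (PiM I (\<lambda>_. unif))"
      unfolding s_def u_def by (intro wsum_measurable last_measurable component_measurable; simp add: I_def)+
    have [measurable]: "Measurable.pred (PiM I (\<lambda>_. unif)) (\<lambda>x. sorted (0 # map x xs))"
      by (intro sorted_measurable component_measurable) (auto simp: I_def)
    have "(\<lambda>x. if sorted (0 # map x xs) then ennreal (exp (- (?E * u x + ?Q * s x))) else 0) \<in> borel_measurable (PiM I (\<lambda>_. unif))"
      by measurable
    then show "(\<lambda>x. indicator {x. sorted (0 # map x xs)} x * ennreal (exp (- (?E * u x + ?Q * s x)))) \<in> borel_measurable (PiM I (\<lambda>_. unif))"
      by (rule measurable_cong[THEN iffD1, rotated]) (simp add: indicator_def)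
  qed
  also have "\<dots> \<le> ennreal p * ennreal (exp (- ((?Q * real (length xs) powr \<mu> + ?E) * 0)) / (\<Prod>l=1..length xs. ?Q * real l powr \<mu> + ?E))"
    unfolding I_def u_def s_def using D cR \<mu> dist by (intro mult_left_mono chain_integral) auto
  also have "\<dots> = ennreal (p / (\<Prod>l=1..length xs. ?Q * real l powr \<mu> + ?E))"
    using p D by (simp flip: ennreal_mult add: prod_nonneg)
  finally have "emeasure M {\<omega> \<in> space M. P (\<lambda>i. Y i \<omega>)} \<le> ennreal (p / (\<Prod>l=1..length xs. ?Q * real l powr \<mu> + ?E))" .
  then have "prob {\<omega> \<in> space M. P (\<lambda>i. Y i \<omega>)} \<le> p / (\<Prod>l=1..length xs. ?Q * real l powr \<mu> + ?E)"
    using p D by (subst (asm) emeasure_eq_measure) (simp add: prod_nonneg)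
  then show ?thesis by (simp only: P_def)
qed

section \<open>The distribution function near zero\<close>

text \<open>
  Both bounds carry the same constant \<open>q\<close>, any number below \<open>1\<close>. The upper one follows from the relative error
  \<open>1 - q\<close> since \<open>q * (2 - q) \<le> 1\<close>.
\<close>
lemma power_law_near_zero:
  fixes F :: "real \<Rightarrow> real"
  assumes \<rho>: "\<rho> > 0" and \<nu>: "\<nu> > 0" and q: "0 < q" "q < 1" and F0: "F 0 = 0"
    and O: "(\<lambda>x. F x - \<rho> * x powr \<nu>) \<in> O[at_right 0](\<lambda>x. x powr (\<nu> + 1))"
  obtains \<delta> where "\<delta> > 0" "\<And>x. 0 \<le> x \<Longrightarrow> x \<le> \<delta> \<Longrightarrow> q * \<rho> * x powr \<nu> \<le> F x"
    "\<And>x. 0 \<le> x \<Longrightarrow> x \<le> \<delta> \<Longrightarrow> q * F x \<le> \<rho> * x powr \<nu>"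
proof -
  from landau_o.bigE[OF O] obtain C where C: "C > 0"
    "eventually (\<lambda>x. norm (F x - \<rho> * x powr \<nu>) \<le> C * norm (x powr (\<nu> + 1))) (at_right 0)" by blast
  from C(2) obtain b where b: "b > 0"
    "\<And>x. 0 < x \<Longrightarrow> x < b \<Longrightarrow> \<bar>F x - \<rho> * x powr \<nu>\<bar> \<le> C * x powr (\<nu> + 1)"
    by (auto simp: eventually_at_right_field)
  define \<delta> where "\<delta> = min (b / 2) (\<rho> * (1 - q) / C)"
  have "\<delta> > 0" using b C q \<rho> by (simp add: \<delta>_def)
  have close: "\<bar>F x - \<rho> * x powr \<nu>\<bar> \<le> \<rho> * (1 - q) * x powr \<nu>" if "0 < x" "x \<le> \<delta>" for x
  proof -
    have "\<bar>F x - \<rho> * x powr \<nu>\<bar> \<le> C * x powr (\<nu> + 1)"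
      using that b by (auto simp: \<delta>_def)
    also have "\<dots> = (C * x) * x powr \<nu>" using that by (simp add: powr_add)
    also have "\<dots> \<le> (\<rho> * (1 - q)) * x powr \<nu>"
      using that C by (intro mult_right_mono) (auto simp: \<delta>_def field_simps)
    finally show ?thesis .
  qed
  show ?thesis
  proof (rule that[OF \<open>\<delta> > 0\<close>])
    fix x assume x: "0 \<le> x" "x \<le> \<delta>"
    show "q * \<rho> * x powr \<nu> \<le> F x"
      using close[of x] x F0 by (cases "x = 0") (auto simp: algebra_simps abs_le_iff)
    show "q * F x \<le> \<rho> * x powr \<nu>"
    proof (cases "x = 0")
      case False
      then have "F x \<le> (2 - q) * (\<rho> * x powr \<nu>)"
        using close[of x] x by (auto simp: algebra_simps abs_le_iff)
      then have "q * F x \<le> q * ((2 - q) * (\<rho> * x powr \<nu>))" using q by (intro mult_left_mono) auto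
      also have "\<dots> = (q * (2 - q)) * (\<rho> * x powr \<nu>)" by simp
      also have "\<dots> \<le> 1 * (\<rho> * x powr \<nu>)"
      proof (intro mult_right_mono)
        have "0 \<le> (1 - q)\<^sup>2" by simp
        then show "q * (2 - q) \<le> 1" by (simp add: power2_eq_square algebra_simps)
      qed (use \<rho> in auto)
      finally show ?thesis by simp
    qed (use F0 in auto)
  qed
qed

text \<open>
  Near zero, \<open>F\<close> at the mean of the \<open>z\<close> is comparable to the \<open>\<nu>\<close>-th power of the mean of the \<open>(F z) powr (1 / \<nu>)\<close>.
  Both directions of the comparison lose a factor \<open>q\<close>, whence \<open>q\<^sup>2\<close>.
\<close>
lemma cdf_ge_wsum:
  fixes F :: "real \<Rightarrow> real"
  assumes mono: "mono F" and F0: "\<And>x. F x \<ge> 0"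
    and \<rho>: "\<rho> > 0" and \<nu>: "\<nu> > 0" and q: "0 < q"
    and low: "\<And>x. 0 \<le> x \<Longrightarrow> x \<le> \<delta> \<Longrightarrow> q * \<rho> * x powr \<nu> \<le> F x"
    and up: "\<And>x. 0 \<le> x \<Longrightarrow> x \<le> \<delta> \<Longrightarrow> q * F x \<le> \<rho> * x powr \<nu>"
    and zs: "sorted zs" "\<And>z. z \<in> set zs \<Longrightarrow> 0 \<le> z" "\<And>z. z \<in> set zs \<Longrightarrow> z \<le> \<delta>" "zs \<noteq> []"
    and t: "sum_list zs \<le> real (length zs) * t"
  shows "q\<^sup>2 / real (length zs) powr (max \<nu> 1) * wsum (max \<nu> 1) (map F zs) \<le> F t"
proof -
  define m where "m = real (length zs)"
  define s where "s = sum_list zs / m"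
  define v where "v = (\<lambda>z. (q * F z / \<rho>) powr (1 / \<nu>))"
  define vs where "vs = map v zs"
  have m: "m > 0" using zs by (simp add: m_def)
  have "sum_list (map (\<lambda>z. z) zs) \<le> sum_list (map (\<lambda>_. \<delta>) zs)"
    using zs by (intro sum_list_mono) auto
  then have s: "0 \<le> s" "s \<le> \<delta>" using m zs
    by (auto simp: s_def m_def sum_list_triv divide_le_eq mult.commute intro!: divide_nonneg_pos sum_list_nonneg)
  have vz: "v z \<le> z" if "z \<in> set zs" for z
  proof -
    have "v z \<le> (z powr \<nu>) powr (1 / \<nu>)"
      unfolding v_def using up[of z] zs that \<rho> \<nu> q F0[of z] by (intro powr_mono2) (auto simp: divide_le_eq mult.commute)
    also have "\<dots> = z" using zs that \<nu> by (simp add: powr_powr)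
    finally show ?thesis .
  qed
  have v_mono: "v x \<le> v y" if "x \<le> y" for x y
    unfolding v_def using monoD[OF mono that] q \<rho> \<nu> F0[of x]
    by (intro powr_mono2) (auto intro!: divide_right_mono mult_left_mono)
  have sorted: "sorted vs"
    unfolding vs_def sorted_map using zs(1) by (rule sorted_wrt_mono_rel[rotated]) (use v_mono in auto)
  have "map (\<lambda>v. v powr \<nu>) vs = map (\<lambda>z. q / \<rho> * F z) zs"
    unfolding vs_def v_def map_map using \<nu> q \<rho> F0 by (intro map_cong) (auto simp: powr_powr)
  then have "wsum (max \<nu> 1) (map (\<lambda>v. v powr \<nu>) vs) = q / \<rho> * wsum (max \<nu> 1) (map F zs)"
    using wsum_mult[of _ "q / \<rho>" "map F zs"] by (simp add: comp_def)
  moreover have "wsum (max \<nu> 1) (map (\<lambda>v. v powr \<nu>) vs) / real (length vs) powr (max \<nu> 1)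
     \<le> (sum_list vs / real (length vs)) powr \<nu>"
    by (intro powr_mean_ge_wsum \<nu> sorted) (use zs in \<open>auto simp: vs_def v_def\<close>)
  ultimately have "q / \<rho> * wsum (max \<nu> 1) (map F zs) / m powr (max \<nu> 1) \<le> (sum_list vs / m) powr \<nu>"
    by (simp add: vs_def m_def)
  also have "\<dots> \<le> s powr \<nu>"
  proof (rule powr_mono2)
    have "sum_list vs \<le> sum_list (map (\<lambda>z. z) zs)" unfolding vs_def using vz by (intro sum_list_mono) auto
    then show "sum_list vs / m \<le> s" using m by (simp add: s_def divide_right_mono)
    show "0 \<le> sum_list vs / m" using m by (intro divide_nonneg_pos sum_list_nonneg) (auto simp: vs_def v_def)
  qed (use \<nu> in auto)
  finally have "(q * \<rho>) * (q / \<rho> * wsum (max \<nu> 1) (map F zs) / m powr (max \<nu> 1)) \<le> (q * \<rho>) * s powr \<nu>"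
    using q \<rho> by (intro mult_left_mono) auto
  also have "\<dots> \<le> F s" using low s by simp
  also have "\<dots> \<le> F t" using t m by (intro monoD[OF mono]) (simp add: s_def m_def divide_le_eq mult.commute)
  finally show ?thesis using \<rho> by (simp add: m_def power2_eq_square)
qed

section \<open>The exponential bound on the support size\<close>

text \<open>
  Let \<open>L\<close> be the minimal value, so that \<open>L \<le> Q l l\<close> for all \<open>l\<close>, and \<open>j\<close> a light row. Taking \<open>Q j j \<ge> L\<close> out of
  the row sum leaves \<open>k - 1\<close> entries with average at most \<open>L\<close>; dropping the other entries instead gives
  \<open>Q j j \<le> k L \<le> k s\<close>. The hypothesis on \<open>(k - 1) * s\<close> makes the \<open>m\<close> smallest entries individually smaller than \<open>\<delta>\<close>, where
  the power law for \<open>F\<close> can be used.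
\<close>
lemma light_row_if_minimizer:
  fixes Q :: "nat \<Rightarrow> nat \<Rightarrow> real" and F :: "real \<Rightarrow> real"
  defines "e \<equiv> \<lambda>j i. (min i j, max i j)"
  assumes mono: "mono F" and F0: "\<And>x. F x \<ge> 0"
    and \<rho>: "\<rho> > 0" and \<nu>: "\<nu> > 0" and q: "0 < q"
    and low: "\<And>x. 0 \<le> x \<Longrightarrow> x \<le> \<delta> \<Longrightarrow> q * \<rho> * x powr \<nu> \<le> F x"
    and up: "\<And>x. 0 \<le> x \<Longrightarrow> x \<le> \<delta> \<Longrightarrow> q * F x \<le> \<rho> * x powr \<nu>"
    and min: "is_global_minimizer n Q x"
    and sym: "\<And>a b. a \<in> {1..n} \<Longrightarrow> b \<in> {1..n} \<Longrightarrow> Q a b = Q b a"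
    and nn: "\<And>a b. a \<in> {1..n} \<Longrightarrow> b \<in> {1..n} \<Longrightarrow> 0 \<le> Q a b"
    and k: "support_size n x = k" and m: "0 < m" "m < k"
    and gap: "real (k - 1) * s < real (k - m) * \<delta>"
    and diag: "l' \<in> {1..n}" "Q l' l' \<le> s"
  shows "\<exists>j\<in>{1..n}. \<exists>xs. set xs \<subseteq> {1..n} - {j} \<and> length xs = m \<and> distinct xs \<and>
    light_row (max \<nu> 1) (q\<^sup>2 / real m powr (max \<nu> 1)) (F (real k * s)) (j, j) (map (e j) xs)
      (e j ` ({1..n} - {j} - set xs)) ((\<lambda>l. (l, l)) ` ({1..n} - {j})) (\<lambda>(a, b). F (Q a b))"
proof -
  define I where "I = {j \<in> {1..n}. x j > 0}"
  define L where "L = quad_form n Q x"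
  have IS: "finite I" "I \<subseteq> {1..n}" "card I = k"
    using k by (auto simp: I_def support_size_def)
  from minimizer_light_row[OF min sym I_def] obtain j where j: "j \<in> I" "(\<Sum>i\<in>I. Q j i) \<le> real k * L"
    using IS by (auto simp: L_def)
  have j': "j \<in> {1..n}" using j IS by auto
  have Lle: "L \<le> Q l l" if "l \<in> {1..n}" for l
    using minimizer_value_le_diagonal[OF min that] by (simp add: L_def)
  have Ls: "L \<le> s" using Lle[OF diag(1)] diag(2) by simp
  define J where "J = I - {j}"
  have J: "J \<subseteq> {1..n} - {j}" "card J = k - 1" "finite J"
    using IS j by (auto simp: J_def)
  have split: "(\<Sum>i\<in>I. Q j i) = Q j j + (\<Sum>i\<in>J. Q j i)"
    unfolding J_def using IS j by (intro sum.remove) auto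
  have kk: "real (k - 1) = real k - 1" using m by (simp add: of_nat_diff)
  have "(\<Sum>i\<in>J. Q j i) \<ge> 0" using J nn j' by (intro sum_nonneg) auto
  then have "Q j j \<le> real k * L" using j split by simp
  also have "\<dots> \<le> real k * s" using Ls by (intro mult_left_mono) auto
  finally have Qjj: "F (Q j j) \<le> F (real k * s)" by (rule monoD[OF mono])
  have sumJ: "(\<Sum>i\<in>J. Q j i) \<le> real (k - 1) * L"
    unfolding kk using j split Lle[OF j'] by (simp add: algebra_simps)
  obtain xs where xs: "distinct xs" "set xs \<subseteq> {1..n} - {j}" "length xs = m" "sorted (map (Q j) xs)"
    "\<And>i. i \<in> {1..n} - {j} - set xs \<Longrightarrow> Q j (last xs) \<le> Q j i"
    "real (k - 1) * (\<Sum>i\<in>set xs. Q j i) \<le> real m * (\<Sum>i\<in>J. Q j i)"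
    "(\<And>i. i \<in> J \<Longrightarrow> 0 \<le> Q j i) \<Longrightarrow> real (k - 1 - m + 1) * Q j (last xs) \<le> (\<Sum>i\<in>J. Q j i)"
    by (rule smallest_entries[of "{1..n} - {j}" J "k - 1" m "Q j"]) (use J m in auto)
  have ne: "xs \<noteq> []" using xs(3) m by auto
  define zs where "zs = map (Q j) xs"
  have "real (k - 1) * sum_list zs \<le> real m * (real (k - 1) * L)"
    using xs(6) sumJ xs(1) order_trans[OF xs(6) mult_left_mono[OF sumJ, of "real m"]]
    by (simp add: zs_def sum_list_distinct_conv_sum_set)
  then have avg: "sum_list zs \<le> real m * L"
    using m by (simp add: mult.left_commute)
  have "real (k - m) * Q j (last xs) \<le> (\<Sum>i\<in>J. Q j i)"
    using xs(7) nn j' J m by (simp add: subset_iff Suc_diff_Suc del: of_nat_diff)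
  also have "\<dots> \<le> real (k - 1) * s"
    using sumJ Ls mult_left_mono[OF Ls, of "real (k - 1)"] by simp
  finally have "real (k - m) * Q j (last xs) < real (k - m) * \<delta>"
    using gap by (rule le_less_trans)
  then have lastd: "Q j (last xs) < \<delta>" by (auto dest: mult_left_less_imp_less)
  have le_last: "Q j i \<le> Q j (last xs)" if "i \<in> set xs" for i
  proof -
    from that obtain a where a: "a < m" "xs ! a = i" using xs(3) by (auto simp: in_set_conv_nth)
    then have "map (Q j) xs ! a \<le> map (Q j) xs ! (m - 1)"
      using xs(3,4) m by (intro sorted_nth_mono) auto
    then show ?thesis using a xs(3) ne m by (simp add: last_conv_nth)
  qed
  have wle: "q\<^sup>2 / real m powr (max \<nu> 1) * wsum (max \<nu> 1) (map F zs) \<le> F (Q l l)" if "l \<in> {1..n}" for l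
  proof -
    have "q\<^sup>2 / real (length zs) powr (max \<nu> 1) * wsum (max \<nu> 1) (map F zs) \<le> F (Q l l)"
    proof (rule cdf_ge_wsum[OF mono F0 \<rho> \<nu> q low up])
      show "sorted zs" by (simp add: zs_def xs)
      show "0 \<le> z" "z \<le> \<delta>" if "z \<in> set zs" for z
        using that nn j' xs(2) le_last lastd by (force simp: zs_def)+
      show "zs \<noteq> []" using ne by (simp add: zs_def)
      have "real m * L \<le> real m * Q l l" using Lle[OF that] by (intro mult_left_mono) auto
      then show "sum_list zs \<le> real (length zs) * Q l l" using avg by (simp add: zs_def xs)
    qed
    then show ?thesis by (simp add: zs_def xs)
  qed
  have Y: "(\<lambda>(a, b). F (Q a b)) (e j i) = F (Q j i)" if "i \<in> {1..n}" for i
    using sym[OF that j'] by (cases "i \<le> j") (auto simp: e_def min_def max_def)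
  have mapY: "map (\<lambda>(a, b). F (Q a b)) (map (e j) xs) = map F zs"
    unfolding zs_def map_map using xs(2) Y by (intro map_cong) auto
  have lastY: "last (0 # map F zs) = F (Q j (last xs))" using ne by (simp add: zs_def last_map)
  have sortY: "sorted (map F zs)"
    unfolding sorted_map using xs(4) unfolding zs_def by (rule sorted_wrt_mono_rel[rotated]) (use monoD[OF mono] in auto)
  have "light_row (max \<nu> 1) (q\<^sup>2 / real m powr (max \<nu> 1)) (F (real k * s)) (j, j) (map (e j) xs)
      (e j ` ({1..n} - {j} - set xs)) ((\<lambda>l. (l, l)) ` ({1..n} - {j})) (\<lambda>(a, b). F (Q a b))"
    unfolding light_row_def mapY lastY
  proof (intro conjI ballI)
    show "sorted (0 # map F zs)" using sortY F0 by simp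
    show "F (Q j (last xs)) \<le> (case r of (a, b) \<Rightarrow> F (Q a b))" if r: "r \<in> e j ` ({1..n} - {j} - set xs)" for r
    proof -
      from r obtain i where i: "r = e j i" "i \<in> {1..n} - {j} - set xs" by (rule imageE)
      then show ?thesis using Y[of i] monoD[OF mono xs(5)[OF i(2)]] by simp
    qed
    show "q\<^sup>2 / real m powr max \<nu> 1 * wsum (max \<nu> 1) (map F zs) \<le> (case w of (a, b) \<Rightarrow> F (Q a b))"
      if "w \<in> (\<lambda>l. (l, l)) ` ({1..n} - {j})" for w
      using that wle by auto
    show "(case (j, j) of (a, b) \<Rightarrow> F (Q a b)) \<le> F (real k * s)" using Qjj by simp
  qed
  with xs j' show ?thesis by blast
qed

text \<open>
  The first term accounts for all diagonal entries exceeding \<open>s\<close>. The second is the union bound over the light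
  row \<open>j\<close> and the list of its \<open>m\<close> smallest entries. The factor \<open>F (k s)\<close>, the probability that the diagonal
  entry of row \<open>j\<close> is at most \<open>k s\<close>, compensates for the \<open>n\<close> choices of \<open>j\<close>.
\<close>
lemma (in prob_space) support_size_prob_le:
  fixes Q :: "nat \<Rightarrow> nat \<Rightarrow> 'a \<Rightarrow> real" and X :: "'a \<Rightarrow> nat \<Rightarrow> real"
  assumes sym: "\<And>i j \<omega>. i \<in> {1..n} \<Longrightarrow> j \<in> {1..n} \<Longrightarrow> \<omega> \<in> space M \<Longrightarrow> Q i j \<omega> = Q j i \<omega>"
    and indep: "indep_vars (\<lambda>_. borel) (\<lambda>(i, j). Q i j) {(i, j). 1 \<le> i \<and> i \<le> j \<and> j \<le> n}"
    and cdf: "\<And>i j. 1 \<le> i \<Longrightarrow> i \<le> j \<Longrightarrow> j \<le> n \<Longrightarrow> cdf (distr M borel (Q i j)) = F"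
    and cont: "continuous_on UNIV F"
    and min: "\<And>\<omega>. \<omega> \<in> space M \<Longrightarrow> is_global_minimizer n (\<lambda>i j. Q i j \<omega>) (X \<omega>)"
    and F0: "F 0 = 0" and \<rho>: "\<rho> > 0" and \<nu>: "\<nu> > 0" and q: "0 < q"
    and low: "\<And>x. 0 \<le> x \<Longrightarrow> x \<le> \<delta> \<Longrightarrow> q * \<rho> * x powr \<nu> \<le> F x"
    and up: "\<And>x. 0 \<le> x \<Longrightarrow> x \<le> \<delta> \<Longrightarrow> q * F x \<le> \<rho> * x powr \<nu>"
    and m: "0 < m" "m < k" and kn: "k < n"
    and gap: "real (k - 1) * s < real (k - m) * \<delta>"
  shows "prob {\<omega> \<in> space M. support_size n (X \<omega>) = k} \<le> (1 - F s) ^ n +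
    real n * F (real k * s) * real (n - 1) ^ m /
      (\<Prod>l=1..m. real (n - 1) * (q\<^sup>2 / real m powr (max \<nu> 1)) * real l powr (max \<nu> 1) + real (n - 1 - m))"
proof -
  define KK where "KK = {(i, j). 1 \<le> i \<and> i \<le> j \<and> j \<le> n}"
  define Y where "Y = (\<lambda>(i, j) \<omega>. F (Q i j \<omega>))"
  \<comment> \<open>The independent entries are those on and above the diagonal; \<open>e j i\<close> is the one shared by rows \<open>i\<close> and \<open>j\<close>.\<close>
  define e where "e = (\<lambda>j i :: nat. (min i j, max i j))"
  define \<mu> where "\<mu> = max \<nu> 1"
  define D where "D = q\<^sup>2 / real m powr \<mu>"
  define p where "p = F (real k * s)"
  define W where "W = (\<lambda>j. (\<lambda>l. (l, l)) ` ({1..n} - {j}))"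
  define R where "R = (\<lambda>j xs. e j ` ({1..n} - {j} - set xs))"
  define T where "T = (\<lambda>j. {xs. (set xs \<subseteq> {1..n} - {j} \<and> length xs = m) \<and> distinct xs})"
  define A where "A = (\<lambda>j xs. {\<omega> \<in> space M. light_row \<mu> D p (j, j) (map (e j) xs) (R j xs) (W j) (\<lambda>i. Y i \<omega>)})"
  define H where "H = {\<omega> \<in> space M. \<forall>l\<in>{1..n}. s < Q l l \<omega>}"
  define Z where "Z = (\<Prod>l=1..m. real (n - 1) * D * real l powr \<mu> + real (n - 1 - m))"
  have rv: "random_variable borel (Q i j)" if "1 \<le> i" "i \<le> j" "j \<le> n" for i j
    using indep that by (auto simp: indep_vars_def)
  have FP: "F x = prob {\<omega> \<in> space M. Q i j \<omega> \<le> x}" if "1 \<le> i" "i \<le> j" "j \<le> n" for i j x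
    unfolding cdf[OF that, symmetric] cdf_def using rv[OF that]
    by (subst measure_distr) (auto intro!: arg_cong[of _ _ prob])
  have n1: "1 \<le> n" using kn by simp
  interpret D: real_distribution "distr M borel (Q 1 1)"
    using rv[of 1 1] n1 by (intro real_distribution_distr) auto
  have mono: "mono F"
    using D.cdf_nondecreasing cdf[of 1 1] n1 by (auto simp: mono_def)
  have F01: "0 \<le> F x" "F x \<le> 1" for x using FP[of 1 1 x] n1 by auto
  have Fm: "F \<in> borel_measurable borel"
    using cont by (rule borel_measurable_continuous_onI)
  have Yi: "indep_vars (\<lambda>_. borel) Y KK"
  proof -
    have "indep_vars (\<lambda>_. borel) (\<lambda>ij \<omega>. F ((case ij of (i, j) \<Rightarrow> Q i j) \<omega>)) KK"
      using indep unfolding KK_def by (rule indep_vars_compose2) (use Fm in auto)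
    then show ?thesis by (simp add: Y_def case_prod_unfold)
  qed
  have Yu: "distr M borel (Y ij) = unif" if ijK: "ij \<in> KK" for ij
  proof -
    obtain i j where ij: "ij = (i, j)" "1 \<le> i" "i \<le> j" "j \<le> n"
      using ijK by (auto simp: KK_def)
    then have "distr M borel (\<lambda>\<omega>. F (Q i j \<omega>)) = unif"
      by (intro probability_integral_transform rv cdf cont)
    with ij show ?thesis by (simp add: Y_def)
  qed
  have Yrv: "random_variable borel (Y ij)" if "ij \<in> KK" for ij
    using Yi that by (auto simp: indep_vars_def)
  have p0: "0 \<le> p" by (simp add: p_def F01)
  have D0: "0 \<le> D" by (simp add: D_def)
  have e_K: "e j i \<in> KK" if "i \<in> {1..n}" "j \<in> {1..n}" for i j
    using that by (auto simp: e_def KK_def min_def max_def)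
  have e_inj: "inj_on (e j) S" for j S
    by (auto simp: inj_on_def e_def min_def max_def split: if_splits)
  have e_diag: "e j i \<noteq> (l, l)" if "i \<noteq> j" for i j l
    using that by (auto simp: e_def min_def max_def split: if_splits)
  have prem: "insert (j, j) (set (map (e j) xs) \<union> R j xs \<union> W j) \<subseteq> KK"
    if "j \<in> {1..n}" "set xs \<subseteq> {1..n} - {j}" for j xs
    using that e_K by (auto simp: R_def W_def) (auto simp: KK_def)
  have A_prob: "prob (A j xs) \<le> p / Z" if j: "j \<in> {1..n}" and xs: "xs \<in> T j" for j xs
  proof -
    have xs': "set xs \<subseteq> {1..n} - {j}" "length xs = m" "distinct xs" using xs by (auto simp: T_def)
    have cx: "card (set xs) = m" using xs' by (simp add: distinct_card)
    have cW: "card (W j) = n - 1" using j by (simp add: W_def card_image inj_on_def)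
    have cR: "card (R j xs) = n - 1 - m"
      using j xs' cx by (simp add: R_def card_image[OF e_inj] card_Diff_subset)
    have "prob (A j xs) \<le> p / (\<Prod>l=1..length (map (e j) xs). real (card (W j)) * D * real l powr \<mu> + real (card (R j xs)))"
      unfolding A_def
    proof (rule chain_event_prob[OF Yi Yu prem[OF j xs'(1)]])
      show "finite (R j xs)" "finite (W j)" by (auto simp: R_def W_def)
      show "distinct (map (e j) xs)" using xs' e_inj by (simp add: distinct_map)
      have off: "e j i \<notin> range (\<lambda>l. (l, l))" if "i \<noteq> j" for i
        using e_diag[OF that] by auto
      have "R j xs \<inter> range (\<lambda>l. (l, l)) = {}"
      proof (intro equals0I, elim IntE)
        fix y assume "y \<in> R j xs" and y: "y \<in> range (\<lambda>l. (l, l))"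
        then obtain i where "y = e j i" "i \<in> {1..n} - {j} - set xs" unfolding R_def by (elim imageE)
        with off[of i] y show False by (simp only:) simp
      qed
      then show "(j, j) \<notin> R j xs" "R j xs \<inter> W j = {}"
        by (auto simp: W_def)
      show "(j, j) \<notin> W j" by (auto simp: W_def)
      have "e j i \<notin> e j ` ({1..n} - {j} - set xs)" if "i \<in> set xs" for i
        using that inj_onD[OF e_inj[of j UNIV]] by blast
      moreover have "e j i \<notin> insert (j, j) (W j)" if "i \<in> set xs" for i
        using that xs' e_diag[of i j] by (auto simp: W_def)
      ultimately have "e j i \<notin> insert (j, j) (R j xs \<union> W j)" if "i \<in> set xs" for i
        unfolding R_def using that by blast
      then show "set (map (e j) xs) \<inter> insert (j, j) (R j xs \<union> W j) = {}"
        unfolding set_map by blast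
      have "card (R j xs) > 0" using cR m kn by simp
      then show "R j xs \<noteq> {}" by auto
      show "\<mu> > 0" by (simp add: \<mu>_def)
    qed (use p0 D0 in auto)
    then show ?thesis unfolding cW cR using xs' by (simp add: Z_def)
  qed
  have A_ev: "A j xs \<in> events" if j: "j \<in> {1..n}" and xs: "xs \<in> T j" for j xs
  proof -
    have "Measurable.pred M (\<lambda>\<omega>. light_row \<mu> D p (j, j) (map (e j) xs) (R j xs) (W j) (\<lambda>i. Y i \<omega>))"
      using prem[OF j, of xs] xs by (intro light_row_measurable Yrv) (auto simp: T_def R_def W_def)
    then show ?thesis unfolding A_def by measurable
  qed
  have Qd [measurable]: "Q l l \<in> borel_measurable M" if "l \<in> {1..n}" for l using that by (intro rv) auto
  have H_ev: "H \<in> events"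
    unfolding H_def by (intro sets.sets_Collect_finite_All) (auto intro!: borel_measurable_less Qd)
  have H_prob: "prob H = (1 - F s) ^ n"
  proof -
    have "prob (\<Inter>ij\<in>(\<lambda>l. (l, l)) ` {1..n}. (case ij of (i, j) \<Rightarrow> Q i j) -` {s<..} \<inter> space M)
        = (\<Prod>ij\<in>(\<lambda>l. (l, l)) ` {1..n}. prob ((case ij of (i, j) \<Rightarrow> Q i j) -` {s<..} \<inter> space M))"
      using n1 by (intro indep_varsD[OF indep]) auto
    also have "\<dots> = (\<Prod>l\<in>{1..n}. prob (Q l l -` {s<..} \<inter> space M))"
      by (subst prod.reindex) (auto simp: inj_on_def)
    also have "\<dots> = (\<Prod>l\<in>{1..n}. 1 - F s)"
    proof (intro prod.cong refl)
      fix l assume l: "l \<in> {1..n}"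
      note [measurable] = Qd[OF l]
      have "Q l l -` {s<..} \<inter> space M = space M - {\<omega> \<in> space M. Q l l \<omega> \<le> s}" by auto
      also have "prob \<dots> = 1 - F s"
        using FP[of l l s] l by (subst prob_compl) auto
      finally show "prob (Q l l -` {s<..} \<inter> space M) = 1 - F s" .
    qed
    finally have "prob (\<Inter>ij\<in>(\<lambda>l. (l, l)) ` {1..n}. (case ij of (i, j) \<Rightarrow> Q i j) -` {s<..} \<inter> space M) = (1 - F s) ^ n" by simp
    moreover have "(\<Inter>ij\<in>(\<lambda>l. (l, l)) ` {1..n}. (case ij of (i, j) \<Rightarrow> Q i j) -` {s<..} \<inter> space M) = H"
      using n1 by (auto simp: H_def)
    ultimately show ?thesis by simp
  qed
  have finT: "finite (T j)" and cardT: "j \<in> {1..n} \<Longrightarrow> card (T j) \<le> (n - 1) ^ m" for j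
  proof -
    let ?L = "{xs. set xs \<subseteq> {1..n} - {j} \<and> length xs = m}"
    have f: "finite ?L" by (intro finite_lists_length_eq) auto
    have s: "T j \<subseteq> ?L" by (auto simp: T_def)
    show "finite (T j)" using f s by (rule finite_subset[rotated])
    show "card (T j) \<le> (n - 1) ^ m" if "j \<in> {1..n}"
      using card_mono[OF f s] that by (simp add: card_lists_length_eq)
  qed
  \<comment> \<open>\<open>F 0 = 0\<close> makes the entries nonnegative, but only almost surely.\<close>
  have AE_nn: "AE \<omega> in M. \<forall>ij\<in>KK. 0 \<le> Q (fst ij) (snd ij) \<omega>"
  proof (intro AE_finite_allI)
    have "KK \<subseteq> {1..n} \<times> {1..n}" by (auto simp: KK_def)
    then show "finite KK" by (rule finite_subset) auto
    fix ij assume ij: "ij \<in> KK"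
    then have [measurable]: "Q (fst ij) (snd ij) \<in> borel_measurable M" by (auto simp: KK_def intro: rv)
    have "prob {\<omega> \<in> space M. Q (fst ij) (snd ij) \<omega> \<le> 0} = 0"
      using FP[of "fst ij" "snd ij" 0] ij F0 by (auto simp: KK_def)
    then have "AE \<omega> in M. \<not> Q (fst ij) (snd ij) \<omega> \<le> 0"
      by (subst (asm) prob_eq_0) auto
    then show "AE \<omega> in M. 0 \<le> Q (fst ij) (snd ij) \<omega>" by eventually_elim auto
  qed
  let ?U = "\<Union>j\<in>{1..n}. \<Union>xs\<in>T j. A j xs"
  have U_ev: "?U \<in> events" using finT A_ev by (intro sets.finite_UN) auto
  have "AE \<omega> in M. \<omega> \<in> {\<omega> \<in> space M. support_size n (X \<omega>) = k} \<longrightarrow> \<omega> \<in> H \<union> ?U"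
    using AE_nn
  proof eventually_elim
    case (elim \<omega>)
    show ?case
    proof (intro impI)
      assume w: "\<omega> \<in> {\<omega> \<in> space M. support_size n (X \<omega>) = k}"
      then have ws: "\<omega> \<in> space M" by simp
      show "\<omega> \<in> H \<union> ?U"
      proof (cases "\<omega> \<in> H")
        case False
        then obtain l where l: "l \<in> {1..n}" "Q l l \<omega> \<le> s" using ws by (auto simp: H_def not_less)
        have nn: "0 \<le> Q a b \<omega>" if ab: "a \<in> {1..n}" "b \<in> {1..n}" for a b
        proof (cases "a \<le> b")
          case True
          then have "(a, b) \<in> KK" using ab by (auto simp: KK_def)
          then show ?thesis using elim by force
        next
          case False
          then have "(b, a) \<in> KK" using ab by (auto simp: KK_def)
          then show ?thesis using elim sym[OF ab ws] by force
        qed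
        have "\<exists>j\<in>{1..n}. \<exists>xs. set xs \<subseteq> {1..n} - {j} \<and> length xs = m \<and> distinct xs \<and>
          light_row (max \<nu> 1) (q\<^sup>2 / real m powr (max \<nu> 1)) (F (real k * s)) (j, j) (map (\<lambda>i. (min i j, max i j)) xs)
            ((\<lambda>i. (min i j, max i j)) ` ({1..n} - {j} - set xs)) ((\<lambda>l. (l, l)) ` ({1..n} - {j})) (\<lambda>(a, b). F (Q a b \<omega>))"
        proof (rule light_row_if_minimizer[where Q = "\<lambda>a b. Q a b \<omega>" and x = "X \<omega>" and l' = l, OF mono F01(1) \<rho> \<nu> q])
          show "is_global_minimizer n (\<lambda>i j. Q i j \<omega>) (X \<omega>)" by (rule min[OF ws])
          show "support_size n (X \<omega>) = k" using w by simp
          show "Q a b \<omega> = Q b a \<omega>" if "a \<in> {1..n}" "b \<in> {1..n}" for a b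
            using sym[OF that ws] .
          show "real (k - 1) * s < real (k - m) * \<delta>" by (rule gap)
        qed (fact low up nn m l)+
        then obtain j xs where jx: "j \<in> {1..n}" "xs \<in> T j"
          "light_row \<mu> D p (j, j) (map (e j) xs) (R j xs) (W j) (\<lambda>(a, b). F (Q a b \<omega>))"
          unfolding T_def e_def R_def W_def D_def p_def \<mu>_def by blast
        moreover have "(\<lambda>(a, b). F (Q a b \<omega>)) = (\<lambda>i. Y i \<omega>)" by (auto simp: Y_def fun_eq_iff)
        ultimately have "\<omega> \<in> A j xs" using ws by (simp add: A_def)
        with jx show ?thesis by blast
      qed simp
    qed
  qed
  then have "prob {\<omega> \<in> space M. support_size n (X \<omega>) = k} \<le> prob (H \<union> ?U)"
    using H_ev U_ev by (intro finite_measure_mono_AE) auto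
  also have "\<dots> \<le> prob H + prob ?U" using H_ev U_ev by (rule measure_Un_le)
  also have "prob ?U \<le> (\<Sum>j\<in>{1..n}. prob (\<Union>xs\<in>T j. A j xs))"
    using finT A_ev by (intro measure_UNION_le) auto
  also have "\<dots> \<le> (\<Sum>j\<in>{1..n}. real (n - 1) ^ m * (p / Z))"
  proof (intro sum_mono)
    fix j assume j: "j \<in> {1..n}"
    have Z0: "0 \<le> Z" unfolding Z_def using D0 by (intro prod_nonneg) auto
    have "prob (\<Union>xs\<in>T j. A j xs) \<le> (\<Sum>xs\<in>T j. prob (A j xs))"
      using finT A_ev j by (intro measure_UNION_le) auto
    also have "\<dots> \<le> (\<Sum>xs\<in>T j. p / Z)" using A_prob j by (intro sum_mono) auto
    also have "\<dots> = real (card (T j)) * (p / Z)" by simp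
    also have "\<dots> \<le> real ((n - 1) ^ m) * (p / Z)"
      using p0 Z0 cardT[OF j] by (intro mult_right_mono) (auto simp del: of_nat_power)
    finally show "prob (\<Union>xs\<in>T j. A j xs) \<le> real (n - 1) ^ m * (p / Z)" by simp
  qed
  also have "\<dots> = real n * p * real (n - 1) ^ m / Z"
  proof -
    have "(\<Sum>j\<in>{1..n}. y) = real n * y" for y :: real by simp
    then show ?thesis by (simp only: times_divide_eq_right times_divide_eq_left mult_ac)
  qed
  finally show ?thesis unfolding H_prob Z_def D_def p_def \<mu>_def by (simp only: add_left_mono)
qed

lemma c_rate_nonneg: "c_rate \<mu> \<ge> 0"
  unfolding c_rate_def
proof (cases "(\<lambda>x::real. ln (1 + x powr \<mu>)) integrable_on {0..1}")
  case True
  then show "0 \<le> integral {0..1} (\<lambda>x. ln (1 + x powr \<mu>))"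
    by (rule integral_nonneg) auto
qed (simp add: not_integrable_integral)

text \<open>
  Since \<open>N - m \<ge> \<kappa> N\<close>, every factor of the denominator is at least \<open>\<kappa> N (1 + (l/m) powr \<mu>)\<close>. The powers of \<open>N\<close> cancel,
  and the logarithm of the remaining product is the Riemann sum of the rate.
\<close>
lemma chain_product_bound:
  fixes N m :: nat
  assumes \<kappa>: "0 < \<kappa>" and N: "N > 0" and m: "m > 0" and mN: "real m \<le> (1 - \<kappa>) * real N" and \<mu>: "\<mu> > 0"
  shows "real N ^ m / (\<Prod>l=1..m. real N * (\<kappa> / real m powr \<mu>) * real l powr \<mu> + real (N - m))
    \<le> \<kappa> powr (- real m) * exp (- c_rate \<mu> * real m)"
proof -
  define w where "w = (\<lambda>l::nat. 1 + (real l / real m) powr \<mu>)"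
  define Z where "Z = (\<Prod>l=1..m. real N * (\<kappa> / real m powr \<mu>) * real l powr \<mu> + real (N - m))"
  have w: "w l > 0" for l unfolding w_def by (simp add: add_pos_nonneg)
  have "m \<le> N"
  proof -
    have "(1 - \<kappa>) * real N \<le> real N" using \<kappa> by (simp add: algebra_simps)
    then show ?thesis using mN by linarith
  qed
  then have Nm: "real (N - m) \<ge> real N * \<kappa>" using mN by (simp add: of_nat_diff algebra_simps)
  have "exp (real m * c_rate \<mu>) \<le> exp (\<Sum>l=1..m. ln (w l))"
    using sum_ln_ge_c_rate[OF \<mu> m] by (simp add: w_def)
  also have "\<dots> = (\<Prod>l=1..m. w l)" using w by (simp add: exp_sum)
  finally have W: "exp (real m * c_rate \<mu>) \<le> (\<Prod>l=1..m. w l)" .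
  have "(real N * \<kappa>) ^ m * exp (real m * c_rate \<mu>) \<le> (real N * \<kappa>) ^ m * (\<Prod>l=1..m. w l)"
    using W \<kappa> by (intro mult_left_mono) auto
  also have "\<dots> = (\<Prod>l=1..m. (real N * \<kappa>) * w l)"
    by (simp add: prod.distrib)
  also have "\<dots> \<le> Z"
    unfolding Z_def
  proof (intro prod_mono conjI)
    fix l
    show "0 \<le> real N * \<kappa> * w l" using \<kappa> w[of l] by simp
    show "real N * \<kappa> * w l \<le> real N * (\<kappa> / real m powr \<mu>) * real l powr \<mu> + real (N - m)"
      using Nm by (simp add: w_def distrib_left powr_divide)
  qed
  finally have le: "(real N * \<kappa>) ^ m * exp (real m * c_rate \<mu>) \<le> Z" .
  have pos: "(real N * \<kappa>) ^ m * exp (real m * c_rate \<mu>) > 0" using N \<kappa> by simp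
  with le have "Z > 0" by linarith
  with le pos have "real N ^ m / Z \<le> real N ^ m / ((real N * \<kappa>) ^ m * exp (real m * c_rate \<mu>))"
    by (intro divide_left_mono) auto
  also have "\<dots> = \<kappa> powr (- real m) * exp (- c_rate \<mu> * real m)"
    using N \<kappa> by (simp add: power_mult_distrib powr_minus powr_realpow exp_minus field_simps)
  finally show ?thesis by (simp add: Z_def)
qed

lemma exp_absorbs_powr:
  fixes C \<nu> \<eta> :: real
  assumes "\<eta> > 0" 
  shows "eventually (\<lambda>k::nat. exp (- real k) + C * real k powr (\<nu> + 1) * exp (\<eta> / 2 * real k) \<le> exp (\<eta> * real k)) sequentially"
proof -
  have "(\<lambda>k::nat. exp (- real k) * exp (- \<eta> * real k) + C * (real k powr (\<nu> + 1) * exp (- (\<eta> / 2) * real k))) \<longlonglongrightarrow> 0 + C * 0"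
    using assms by (intro tendsto_intros; real_asymp)
  then have "eventually (\<lambda>k::nat. exp (- real k) * exp (- \<eta> * real k) + C * (real k powr (\<nu> + 1) * exp (- (\<eta> / 2) * real k)) < 1) sequentially"
    by (rule order_tendstoD) simp
  then show ?thesis
  proof eventually_elim
    case (elim k)
    then have "exp (\<eta> * real k) * (exp (- real k) * exp (- \<eta> * real k) + C * (real k powr (\<nu> + 1) * exp (- (\<eta> / 2) * real k))) \<le> exp (\<eta> * real k) * 1"
      by (intro mult_left_mono) auto
    moreover have e1: "exp (\<eta> * real k) * (exp (- real k) * exp (- \<eta> * real k)) = exp (- real k)"
      by (simp flip: exp_add)
    have "exp (\<eta> * real k) * exp (- (\<eta> / 2) * real k) = exp (\<eta> / 2 * real k)"
      by (simp flip: exp_add)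
    then have e2: "exp (\<eta> * real k) * (C * (real k powr (\<nu> + 1) * exp (- (\<eta> / 2) * real k))) = C * real k powr (\<nu> + 1) * exp (\<eta> / 2 * real k)"
      by (simp add: mult_ac)
    ultimately show ?case by (simp only: distrib_left e1 e2 mult_1_right)
  qed
qed

text \<open>
  For \<open>k \<le> \<theta> n\<close> with small \<open>\<theta>\<close> the smallest diagonal entry lies, up to a negligible probability, where the
  power law is accurate, and the list of smallest entries of the row is a negligible part of the row. The loss \<open>\<eta> k\<close> in the exponent pays for the constant \<open>\<kappa>\<close> in the product, for
  the discarded share \<open>\<epsilon>\<close> of the entries, and for the polynomial factor from the choice of the row.
\<close>
lemma support_size_exponential_bound:
  fixes M :: "nat \<Rightarrow> 'a measure"
    and Q :: "nat \<Rightarrow> nat \<Rightarrow> nat \<Rightarrow> 'a \<Rightarrow> real"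
    and X :: "nat \<Rightarrow> 'a \<Rightarrow> nat \<Rightarrow> real"
  assumes M: "\<And>n. n \<ge> 1 \<Longrightarrow> prob_space (M n)"
    and sym: "\<And>n i j \<omega>. i \<in> {1..n} \<Longrightarrow> j \<in> {1..n} \<Longrightarrow> \<omega> \<in> space (M n) \<Longrightarrow> Q n i j \<omega> = Q n j i \<omega>"
    and indep: "\<And>n. n \<ge> 1 \<Longrightarrow>
           prob_space.indep_vars (M n) (\<lambda>_. borel) (\<lambda>(i, j). Q n i j)
             {(i, j). 1 \<le> i \<and> i \<le> j \<and> j \<le> n}"
    and cdf: "\<And>n i j. 1 \<le> i \<Longrightarrow> i \<le> j \<Longrightarrow> j \<le> n \<Longrightarrow> cdf (distr (M n) borel (Q n i j)) = F"
    and cont: "continuous_on UNIV F"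
    and min: "\<And>n \<omega>. n \<ge> 1 \<Longrightarrow> \<omega> \<in> space (M n) \<Longrightarrow>
           is_global_minimizer n (\<lambda>i j. Q n i j \<omega>) (X n \<omega>)"
    and F0: "F 0 = 0" and \<nu>: "\<nu> > 0" and \<rho>: "\<rho> > 0"
    and O: "(\<lambda>x. F x - \<rho> * x powr \<nu>) \<in> O[at_right 0](\<lambda>x. x powr (\<nu> + 1))"
    and \<eta>: "\<eta> > 0"
  shows "\<exists>\<theta>>0. \<exists>k0. \<forall>n k. n \<ge> 1 \<longrightarrow> k \<ge> k0 \<longrightarrow> real k \<le> \<theta> * real n \<longrightarrow>
    measure (M n) {\<omega> \<in> space (M n). support_size n (X n \<omega>) = k} \<le> exp ((\<eta> - c_rate (max \<nu> 1)) * real k)"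
proof -
  define c where "c = c_rate (max \<nu> 1)"
  define q where "q = exp (- \<eta> / 8)"
  define \<kappa> where "\<kappa> = exp (- \<eta> / 4)"
  define \<epsilon> where "\<epsilon> = min (1/2) (\<eta> / (4 * (1 + c)))"
  \<comment> \<open>Chosen so that all diagonal entries exceed \<open>s\<close>, defined below, with probability at most \<open>exp (- (1 + c) k)\<close>.\<close>
  define D where "D = (1 + c) / (q * \<rho>)"
  have c: "c \<ge> 0" by (simp add: c_def c_rate_nonneg)
  have q: "0 < q" "q < 1" using \<eta> by (auto simp: q_def)
  have \<kappa>: "0 < \<kappa>" "\<kappa> < 1" using \<eta> by (auto simp: \<kappa>_def)
  have q2: "q\<^sup>2 = \<kappa>" by (simp add: q_def \<kappa>_def power2_eq_square flip: exp_add)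
  have \<epsilon>: "0 < \<epsilon>" "\<epsilon> \<le> 1/2"
    using \<eta> c unfolding \<epsilon>_def by (simp, blast intro: min.cobounded1)
  have c\<epsilon>: "c * \<epsilon> \<le> \<eta> / 4"
  proof -
    have "c * \<epsilon> \<le> (1 + c) * (\<eta> / (4 * (1 + c)))"
      using c \<eta> \<epsilon> by (intro mult_mono) (auto simp: \<epsilon>_def)
    also have "\<dots> = \<eta> / 4" using c by (simp add: field_simps)
    finally show ?thesis .
  qed
  have D: "D > 0" using c q \<rho> by (simp add: D_def)
  obtain \<delta> where \<delta>: "\<delta> > 0" and low: "\<And>x. 0 \<le> x \<Longrightarrow> x \<le> \<delta> \<Longrightarrow> q * \<rho> * x powr \<nu> \<le> F x"
    and up: "\<And>x. 0 \<le> x \<Longrightarrow> x \<le> \<delta> \<Longrightarrow> q * F x \<le> \<rho> * x powr \<nu>"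
    by (rule power_law_near_zero[OF \<rho> \<nu> q F0 O]) blast
  have F1: "F x \<le> 1" for x
  proof -
    interpret P: prob_space "M 1" by (rule M) simp
    have "\<forall>ij\<in>{(i, j). 1 \<le> i \<and> i \<le> j \<and> j \<le> (1::nat)}. (case ij of (i, j) \<Rightarrow> Q 1 i j) \<in> borel_measurable (M 1)"
      using indep[OF order_refl] unfolding P.indep_vars_def by (rule conjunct1)
    from bspec[OF this, of "(1, 1)"] have "Q 1 1 1 \<in> borel_measurable (M 1)" by simp
    then interpret R: real_distribution "distr (M 1) borel (Q 1 1 1)" by (rule P.real_distribution_distr)
    show ?thesis using R.cdf_bounded_prob[of x] cdf[of 1 1 1] by simp
  qed
  \<comment> \<open>A power bound for \<open>F\<close> on all of \<open>[0, \<infinity>)\<close>, with a worse constant: \<open>k s\<close> need not be small.\<close>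
  define C where "C = max (\<rho> / q) (1 / \<delta> powr \<nu>)"
  have C: "C > 0" using \<rho> q by (simp add: C_def less_max_iff_disj)
  have FC: "F x \<le> C * x powr \<nu>" if x: "0 \<le> x" for x
  proof (cases "x \<le> \<delta>")
    case True
    then have "F x \<le> \<rho> / q * x powr \<nu>" using up[OF x] q by (simp add: field_simps)
    also have "\<dots> \<le> C * x powr \<nu>" by (intro mult_right_mono) (auto simp: C_def)
    finally show ?thesis .
  next
    case False
    have "F x \<le> 1 / \<delta> powr \<nu> * \<delta> powr \<nu>" using F1[of x] \<delta> by simp
    also have "\<dots> \<le> C * x powr \<nu>"
      using False \<delta> \<nu> C by (intro mult_mono powr_mono2) (auto simp: C_def)
    finally show ?thesis .
  qed
  define \<theta> where "\<theta> = min (min (1/2) (1 - \<kappa>)) ((\<epsilon> * \<delta>) powr \<nu> / D)"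
  have \<theta>_le: "\<theta> \<le> 1/2" "\<theta> \<le> 1 - \<kappa>" "\<theta> \<le> (\<epsilon> * \<delta>) powr \<nu> / D"
    unfolding \<theta>_def by linarith+
  have \<theta>: "0 < \<theta>" using \<kappa> \<epsilon> \<delta> D by (simp add: \<theta>_def)
  from exp_absorbs_powr[OF \<eta>, of "C * D * exp c" \<nu>] obtain k1 where
    k1: "\<And>k::nat. k \<ge> k1 \<Longrightarrow> exp (- real k) + C * D * exp c * real k powr (\<nu> + 1) * exp (\<eta> / 2 * real k) \<le> exp (\<eta> * real k)"
    by (auto simp: eventually_sequentially)
  have main: "measure (M n) {\<omega> \<in> space (M n). support_size n (X n \<omega>) = k} \<le> exp ((\<eta> - c) * real k)"
    if n: "n \<ge> 1" and k: "k \<ge> max k1 2" and kn: "real k \<le> \<theta> * real n" for n k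
  proof -
    interpret prob_space "M n" using n by (rule M)
    \<comment> \<open>Solves \<open>s powr \<nu> = D k / n\<close>, so that typically of the order of \<open>k\<close> diagonal entries lie below \<open>s\<close>.\<close>
    define s where "s = (D * real k / real n) powr (1 / \<nu>)"
    \<comment> \<open>The number of discarded entries; \<open>s \<le> \<epsilon> \<delta>\<close> will ensure that no more than these exceed \<open>\<delta>\<close>.\<close>
    define d where "d = nat \<lfloor>\<epsilon> * real (k - 1)\<rfloor>"
    define m where "m = k - 1 - d"
    have k2: "k \<ge> 2" and n0: "real n > 0" using k n by auto
    have "\<theta> * real n \<le> 1 / 2 * real n" using n0 \<theta>_le by (intro mult_right_mono) auto
    then have kn2: "k < n" using kn n0 k2 by linarith
    have d: "real d \<le> \<epsilon> * real (k - 1)" "\<epsilon> * real (k - 1) < real d + 1"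
      using \<epsilon> unfolding d_def by (auto simp: floor_less_iff le_floor_iff)
    have "\<epsilon> * real (k - 1) \<le> 1 / 2 * real (k - 1)" using \<epsilon> by (intro mult_right_mono) auto
    then have "real d < real (k - 1)" using d k2 by linarith
    then have dk: "d < k - 1" by simp
    have m: "0 < m" "m < k" using dk k2 by (auto simp: m_def)
    have km: "real (k - m) = real d + 1" using dk k2 by (simp add: m_def)
    have s0: "0 \<le> s" by (simp add: s_def)
    have s\<nu>: "s powr \<nu> = D * real k / real n" using \<nu> D k2 n0 by (simp add: s_def powr_powr)
    have "D * real k / real n \<le> D * (\<theta> * real n) / real n"
      using kn D n0 by (intro divide_right_mono mult_left_mono) auto
    also have "\<dots> = D * \<theta>" using n0 by simp
    also have "\<dots> \<le> D * ((\<epsilon> * \<delta>) powr \<nu> / D)" using D \<theta>_le by (intro mult_left_mono) auto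
    also have "\<dots> = (\<epsilon> * \<delta>) powr \<nu>" using D by simp
    finally have "s \<le> ((\<epsilon> * \<delta>) powr \<nu>) powr (1 / \<nu>)"
      unfolding s_def using D \<nu> by (intro powr_mono2) auto
    also have "\<dots> = \<epsilon> * \<delta>" using \<epsilon> \<delta> \<nu> by (simp add: powr_powr)
    finally have s\<epsilon>: "s \<le> \<epsilon> * \<delta>" .
    also have "\<epsilon> * \<delta> \<le> 1 * \<delta>" using \<epsilon> \<delta> by (intro mult_right_mono) auto
    finally have s\<delta>: "s \<le> \<delta>" by simp
    have gap: "real (k - 1) * s < real (k - m) * \<delta>"
    proof -
      have "real (k - 1) * s \<le> real (k - 1) * (\<epsilon> * \<delta>)" using s\<epsilon> by (intro mult_left_mono) auto
      also have "\<dots> = (\<epsilon> * real (k - 1)) * \<delta>" by simp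
      also have "\<dots> < (real d + 1) * \<delta>" using d \<delta> by (intro mult_strict_right_mono) auto
      finally show ?thesis by (simp only: km)
    qed
    have "(1 - F s) ^ n \<le> exp (- F s) ^ n"
      using F1[of s] exp_ge_add_one_self[of "- F s"] by (intro power_mono) auto
    also have "\<dots> = exp (- (real n * F s))" by (simp flip: exp_of_nat_mult)
    also have "\<dots> \<le> exp (- (1 + c) * real k)"
    proof -
      have "(1 + c) * real k = real n * (q * \<rho> * s powr \<nu>)"
        unfolding s\<nu> using n0 q \<rho> by (simp add: D_def)
      also have "\<dots> \<le> real n * F s" using low[OF s0 s\<delta>] by (intro mult_left_mono) auto
      finally show ?thesis by (simp add: algebra_simps)
    qed
    finally have no_small_diag: "(1 - F s) ^ n \<le> exp (- (1 + c) * real k)" .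
    have "real n * F (real k * s) \<le> real n * (C * (real k * s) powr \<nu>)"
      using s0 by (intro mult_left_mono FC) auto
    also have "\<dots> = C * D * real k powr (\<nu> + 1)"
      using s0 n0 k2 by (simp add: powr_mult s\<nu> powr_add)
    finally have small_candidates: "real n * F (real k * s) \<le> C * D * real k powr (\<nu> + 1)" .
    have "real m \<le> real k - 1" using m by linarith
    also have "\<dots> \<le> (1 - \<kappa>) * real n - (1 - \<kappa>)"
    proof -
      have "\<theta> * real n \<le> (1 - \<kappa>) * real n" using n0 \<theta>_le by (intro mult_right_mono) auto
      then show ?thesis using kn \<kappa> by linarith
    qed
    also have "\<dots> = (1 - \<kappa>) * real (n - 1)" using n by (simp add: of_nat_diff algebra_simps)
    finally have "real (n - 1) ^ m /
       (\<Prod>l=1..m. real (n - 1) * (\<kappa> / real m powr (max \<nu> 1)) * real l powr (max \<nu> 1) + real (n - 1 - m))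
      \<le> \<kappa> powr (- real m) * exp (- c_rate (max \<nu> 1) * real m)"
      using kn2 k2 m \<kappa> by (intro chain_product_bound) auto
    also have "\<dots> \<le> exp (\<eta> / 4 * real k) * exp (c + \<eta> / 4 * real k - c * real k)"
    proof (intro mult_mono)
      have "\<kappa> powr (- real m) = exp (\<eta> / 4 * real m)" by (simp add: \<kappa>_def powr_def)
      also have "\<dots> \<le> exp (\<eta> / 4 * real k)" using m \<eta> by simp
      finally show "\<kappa> powr (- real m) \<le> exp (\<eta> / 4 * real k)" .
      have "real m = real k - 1 - real d" using dk k2 by (simp add: m_def of_nat_diff)
      then have "c * real m = c * real k - c - c * real d" by (simp only: right_diff_distrib mult_1_right)
      moreover have "real d \<le> \<epsilon> * real k"
        using d \<epsilon> by (elim order_trans) (intro mult_left_mono, auto)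
      then have "c * real d \<le> \<eta> / 4 * real k"
        using mult_left_mono[of "real d" "\<epsilon> * real k" c] mult_right_mono[OF c\<epsilon>, of "real k"] c by simp
      ultimately have "- (c * real m) \<le> c + \<eta> / 4 * real k - c * real k" by linarith
      then show "exp (- c_rate (max \<nu> 1) * real m) \<le> exp (c + \<eta> / 4 * real k - c * real k)"
        by (simp add: c_def)
    qed auto
    finally have chains: "real (n - 1) ^ m /
       (\<Prod>l=1..m. real (n - 1) * (\<kappa> / real m powr (max \<nu> 1)) * real l powr (max \<nu> 1) + real (n - 1 - m))
      \<le> exp (\<eta> / 4 * real k) * exp (c + \<eta> / 4 * real k - c * real k)" .
    have "prob {\<omega> \<in> space (M n). support_size n (X n \<omega>) = k} \<le> (1 - F s) ^ n +
      real n * F (real k * s) * real (n - 1) ^ m /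
      (\<Prod>l=1..m. real (n - 1) * (q\<^sup>2 / real m powr (max \<nu> 1)) * real l powr (max \<nu> 1) + real (n - 1 - m))"
      by (rule support_size_prob_le[OF sym indep[OF n] cdf cont min[OF n] F0 \<rho> \<nu> q(1) low up m kn2 gap])
    also have "\<dots> = (1 - F s) ^ n + real n * F (real k * s) * (real (n - 1) ^ m /
      (\<Prod>l=1..m. real (n - 1) * (\<kappa> / real m powr (max \<nu> 1)) * real l powr (max \<nu> 1) + real (n - 1 - m)))"
      by (simp add: q2)
    also have "\<dots> \<le> exp (- (1 + c) * real k) +
       C * D * real k powr (\<nu> + 1) * (exp (\<eta> / 4 * real k) * exp (c + \<eta> / 4 * real k - c * real k))"
      by (intro no_small_diag small_candidates chains add_mono mult_mono) (use C D \<kappa> in \<open>auto intro!: divide_nonneg_nonneg prod_nonneg\<close>)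
    also have "\<dots> = exp (- c * real k) * (exp (- real k) + C * D * exp c * real k powr (\<nu> + 1) * exp (\<eta> / 2 * real k))"
    proof -
      have 1: "exp (- (1 + c) * real k) = exp (- c * real k) * exp (- real k)"
        by (simp add: algebra_simps flip: exp_add)
      have 2: "exp (\<eta> / 4 * real k) * exp (c + \<eta> / 4 * real k - c * real k) = exp (- c * real k) * (exp c * exp (\<eta> / 2 * real k))"
        by (simp add: algebra_simps flip: exp_add)
      show ?thesis unfolding 1 2 by (simp add: algebra_simps)
    qed
    also have "\<dots> \<le> exp (- c * real k) * exp (\<eta> * real k)"
      using k1[of k] k by (intro mult_left_mono) auto
    also have "\<dots> = exp ((\<eta> - c) * real k)" by (simp add: algebra_simps flip: exp_add)
    finally show ?thesis .
  qed
  show ?thesis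
    using \<theta> main unfolding c_def[symmetric] by blast
qed

text \<open>
  Along the joint filter \<open>k\<close> is of order at most \<open>sqrt n\<close>, hence eventually below any fixed multiple of \<open>n\<close>.
\<close>
lemma joint_filter_tendsto_0I:
  fixes r :: "nat \<Rightarrow> nat \<Rightarrow> real"
  assumes "\<And>\<eta>. \<eta> > 0 \<Longrightarrow> \<exists>\<theta>>0. \<exists>k0. \<forall>n k. n \<ge> 1 \<longrightarrow> k \<ge> k0 \<longrightarrow> k \<le> k_max \<alpha> n \<longrightarrow> real k \<le> \<theta> * real n \<longrightarrow> \<bar>r n k\<bar> \<le> \<eta> * real k"
    and \<alpha>: "\<alpha> > 0"
  shows "((\<lambda>(n, k). r n k / real k) \<longlongrightarrow> 0) (joint_filter \<alpha>)"
proof (rule tendstoI)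
  fix e :: real assume e: "e > 0"
  from assms(1)[of "e / 2"] e obtain \<theta> k0 where \<theta>: "\<theta> > 0" and
    r: "\<And>n k. n \<ge> 1 \<Longrightarrow> k \<ge> k0 \<Longrightarrow> k \<le> k_max \<alpha> n \<Longrightarrow> real k \<le> \<theta> * real n \<Longrightarrow> \<bar>r n k\<bar> \<le> e / 2 * real k"
    by auto
  have "eventually (\<lambda>n::nat. \<alpha> * sqrt (real n) + 1 \<le> \<theta> * real n) sequentially"
    using \<theta> \<alpha> by real_asymp
  then have "eventually (\<lambda>n::nat. \<alpha> * sqrt (real n) + 1 \<le> \<theta> * real n \<and> n \<ge> 1) sequentially"
    by (intro eventually_conj eventually_ge_at_top)
  moreover have "eventually (\<lambda>k::nat. k \<ge> max k0 1) sequentially" by (rule eventually_ge_at_top)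
  ultimately have "eventually (\<lambda>x. (\<alpha> * sqrt (real (fst x)) + 1 \<le> \<theta> * real (fst x) \<and> fst x \<ge> 1) \<and> snd x \<ge> max k0 1)
      (sequentially \<times>\<^sub>F sequentially)"
    by (rule eventually_prodI)
  then show "eventually (\<lambda>x. dist (case x of (n, k) \<Rightarrow> r n k / real k) 0 < e) (joint_filter \<alpha>)"
    unfolding joint_filter_def eventually_inf_principal
  proof eventually_elim
    case (elim nk)
    obtain n k where nk: "nk = (n, k)" by (cases nk)
    show ?case
    proof
      assume "nk \<in> {(n, k). k \<le> k_max \<alpha> n}"
      then have k: "k \<le> k_max \<alpha> n" by (simp add: nk)
      have "real k \<le> of_int \<lceil>\<alpha> * sqrt (real n)\<rceil>"
      proof -
        have "0 \<le> \<lceil>\<alpha> * sqrt (real n)\<rceil>" using \<alpha> by (simp add: le_ceiling_iff order_less_le_trans[of "-1" 0])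
        then show ?thesis using k unfolding k_max_def by linarith
      qed
      also have "\<dots> \<le> \<alpha> * sqrt (real n) + 1" by linarith
      finally have "real k \<le> \<theta> * real n" using elim nk by auto
      with elim k nk have "\<bar>r n k\<bar> \<le> e / 2 * real k" by (intro r) auto
      moreover have "real k > 0" using elim nk by auto
      ultimately have "\<bar>r n k / real k\<bar> \<le> e / 2" by (simp add: abs_divide divide_le_eq)
      also have "\<dots> < e" using e by simp
      finally show "dist (case nk of (n, k) \<Rightarrow> r n k / real k) 0 < e" by (simp add: nk)
    qed
  qed
qed

theorem theorem1p2:
  fixes M :: "nat \<Rightarrow> 'a measure"
    and Q :: "nat \<Rightarrow> nat \<Rightarrow> nat \<Rightarrow> 'a \<Rightarrow> real"
    and X :: "nat \<Rightarrow> 'a \<Rightarrow> nat \<Rightarrow> real"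
    and F f :: "real \<Rightarrow> real"
    and B :: ereal
    and \<nu> \<rho> \<alpha> :: real
  assumes "\<And>n. n \<ge> 1 \<Longrightarrow> prob_space (M n)"
    and "\<And>n i j \<omega>. i \<in> {1..n} \<Longrightarrow> j \<in> {1..n} \<Longrightarrow> \<omega> \<in> space (M n) \<Longrightarrow> Q n i j \<omega> = Q n j i \<omega>"
    and "\<And>n. n \<ge> 1 \<Longrightarrow>
           prob_space.indep_vars (M n) (\<lambda>_. borel) (\<lambda>(i, j). Q n i j)
             {(i, j). 1 \<le> i \<and> i \<le> j \<and> j \<le> n}"
    and "\<And>n i j. 1 \<le> i \<Longrightarrow> i \<le> j \<Longrightarrow> j \<le> n \<Longrightarrow> cdf (distr (M n) borel (Q n i j)) = F"
    and "continuous_on UNIV F"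
    and "\<And>n \<omega>. n \<ge> 1 \<Longrightarrow> \<omega> \<in> space (M n) \<Longrightarrow>
           is_global_minimizer n (\<lambda>i j. Q n i j \<omega>) (X n \<omega>)"
    and "\<And>n. n \<ge> 1 \<Longrightarrow>
           (\<lambda>\<omega>. support_size n (X n \<omega>)) \<in> measurable (M n) (count_space UNIV)"
    and "has_density F f"
    and "0 < B"
    and "continuous_on {x. 0 < x \<and> ereal x < B} f"
    and "\<And>x. \<not> (0 \<le> x \<and> ereal x < B) \<Longrightarrow> f x = 0"
    and "\<And>x. 0 \<le> x \<Longrightarrow> ereal x < B \<Longrightarrow> f x > 0"
    and "\<nu> > 0" and "\<rho> > 0"
    and "(\<lambda>x. F x - \<rho> * x powr \<nu>) \<in> O[at_right 0](\<lambda>x. x powr (\<nu> + 1))"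
    and "Sup {ereal (f x' / f x) | x x'.
           0 < x \<and> ereal x < B \<and> 0 < x' \<and> ereal x' < B \<and> x' \<in> {x<..<2 * x}} < \<infinity>"
    and "\<alpha> > exp 1 * sqrt 2"
  shows "(\<exists>r :: nat \<Rightarrow> nat \<Rightarrow> real.
            ((\<lambda>(n, k). r n k / real k) \<longlongrightarrow> 0) (joint_filter \<alpha>) \<and>
            (\<forall>n k. n \<ge> 1 \<longrightarrow> k \<le> k_max \<alpha> n \<longrightarrow>
               measure (M n) {\<omega> \<in> space (M n). support_size n (X n \<omega>) = k}
                 \<le> exp (- c_rate (max \<nu> 1) * real k + r n k))) \<and>
         (\<forall>\<mu>>0. (\<lambda>j. (-1) ^ j / (real (j + 1) * (real (j + 1) * \<mu> + 1))) sums c_rate \<mu>)"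
proof (intro conjI allI impI)
  define c where "c = c_rate (max \<nu> 1)"
  define P where "P = (\<lambda>n k. measure (M n) {\<omega> \<in> space (M n). support_size n (X n \<omega>) = k})"
  \<comment> \<open>The smallest nonnegative error that makes the bound true; the value where \<open>P n k = 0\<close> is arbitrary.\<close>
  define r where "r = (\<lambda>n k. if P n k > 0 then max 0 (ln (P n k) + c * real k) else 0)"
  have \<alpha>: "\<alpha> > 0"
    using assms(17) by (rule less_trans[rotated]) simp
  have "(F \<longlongrightarrow> F 0) (at_right 0)"
    using assms(5) by (auto simp: continuous_on_def intro: tendsto_within_subset)
  moreover have "(F \<longlongrightarrow> 0) (at_right 0)"
  proof -
    have x0: "((\<lambda>x::real. x powr (\<nu> + 1)) \<longlongrightarrow> 0) (at_right 0)" and "((\<lambda>x::real. \<rho> * x powr \<nu>) \<longlongrightarrow> 0) (at_right 0)"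
      using \<open>\<nu> > 0\<close> by real_asymp+
    moreover have "((\<lambda>x. F x - \<rho> * x powr \<nu>) \<longlongrightarrow> 0) (at_right 0)"
    proof -
      from landau_o.bigE[OF assms(15)] obtain C where
        "eventually (\<lambda>x. norm (F x - \<rho> * x powr \<nu>) \<le> C * norm (x powr (\<nu> + 1))) (at_right 0)" by blast
      moreover have "((\<lambda>x::real. C * norm (x powr (\<nu> + 1))) \<longlongrightarrow> 0) (at_right 0)"
        using tendsto_mult[OF tendsto_const[of C] tendsto_norm[OF x0]] by simp
      ultimately show ?thesis by (rule Lim_null_comparison)
    qed
    ultimately have "((\<lambda>x. (F x - \<rho> * x powr \<nu>) + \<rho> * x powr \<nu>) \<longlongrightarrow> 0 + 0) (at_right 0)"
      by (intro tendsto_add)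
    then show ?thesis by simp
  qed
  ultimately have F0: "F 0 = 0" by (rule tendsto_unique[rotated]) simp
  have "((\<lambda>(n, k). r n k / real k) \<longlongrightarrow> 0) (joint_filter \<alpha>)"
  proof (rule joint_filter_tendsto_0I[OF _ \<alpha>])
    fix \<eta> :: real assume \<eta>: "\<eta> > 0"
    from support_size_exponential_bound[OF assms(1-6) F0 assms(13-15) \<eta>]
    obtain \<theta> k0 where \<theta>: "\<theta> > 0" and bound: "\<And>n k. n \<ge> 1 \<Longrightarrow> k \<ge> k0 \<Longrightarrow> real k \<le> \<theta> * real n \<Longrightarrow>
      P n k \<le> exp ((\<eta> - c) * real k)" unfolding P_def c_def by blast
    have "\<bar>r n k\<bar> \<le> \<eta> * real k" if "n \<ge> 1" "k \<ge> k0" "real k \<le> \<theta> * real n" for n k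
    proof (cases "P n k > 0")
      case True
      then have "ln (P n k) \<le> ln (exp ((\<eta> - c) * real k))"
        using bound[OF that] by (subst ln_le_cancel_iff) auto
      then show ?thesis using True \<eta> by (simp add: r_def algebra_simps)
    qed (use \<eta> in \<open>simp add: r_def\<close>)
    with \<theta> show "\<exists>\<theta>>0. \<exists>k0. \<forall>n k. n \<ge> 1 \<longrightarrow> k \<ge> k0 \<longrightarrow> k \<le> k_max \<alpha> n \<longrightarrow> real k \<le> \<theta> * real n \<longrightarrow> \<bar>r n k\<bar> \<le> \<eta> * real k"
      by blast
  qed
  moreover have "P n k \<le> exp (- c * real k + r n k)" for n k
  proof (cases "P n k > 0")
    case True
    then have "P n k = exp (ln (P n k))" by simp
    also have "\<dots> \<le> exp (- c * real k + r n k)"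
      unfolding exp_le_cancel_iff using True by (simp add: r_def)
    finally show ?thesis .
  qed (simp add: order_trans[of _ 0])
  ultimately show "\<exists>r :: nat \<Rightarrow> nat \<Rightarrow> real.
            ((\<lambda>(n, k). r n k / real k) \<longlongrightarrow> 0) (joint_filter \<alpha>) \<and>
            (\<forall>n k. n \<ge> 1 \<longrightarrow> k \<le> k_max \<alpha> n \<longrightarrow>
               measure (M n) {\<omega> \<in> space (M n). support_size n (X n \<omega>) = k}
                 \<le> exp (- c_rate (max \<nu> 1) * real k + r n k))"
    unfolding P_def c_def by blast
qed (rule c_rate_sums)

end
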